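(* For all positive integers $n,m$, the Eulerian polynomials satisfy $$A_{n+m}(x)=A_n(x)\cdot A_m(x)+x\cdot\sum_{0<r\le n,\;0<s\le m}\binom{n}{r}\binom{m}{s}A_r(x)\,A_s(x)\,A_{n+m-r-s}(x).$$
   Context: $A_n(x)=\sum_{k=0}^nA(n,k)x^k$ is the Eulerian polynomial, defined as the Hilbert series of the Chow ring of the boolean matroid on $[n]$ (the matroid all of whose subsets are flats), i.e. of the graded ring $\mathbb{Q}[x_F:\emptyset\subsetneq F\subsetneq[n]]/(I+J)$ with $\deg x_F=1$, $I$ generated by $\sum_{F\not\ni i}x_F-\sum_{F\not\ni j}x_F$ for $i,j\in[n]$, and $J$ generated by $x_Fx_{F'}$ for incomparable $F,F'$. Its coefficients $A(n,k)$ are the Eulerian numbers: $A(n,k)$ is the number of permutations of $[n]$ with exactly $k$ descents. In particular $A_0(x)=A_1(x)=1$ and $A_2(x)=1+x$. *)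

theory Defs
  imports
    "HOL-Library.Poly_Mapping"
    "HOL-Algebra.Algebra"
    "HOL-Computational_Algebra.Polynomial_FPS"
begin

text \<open>
  The element \<open>m\<close> of \<open>nat set \<Rightarrow>\<^sub>0 nat\<close> stands for the monomial whose variable \<open>x\<^sub>F\<close> has
  exponent \<open>lookup m F\<close>.  Multiplication in \<open>(nat set \<Rightarrow>\<^sub>0 nat) \<Rightarrow>\<^sub>0 rat\<close> is convolution, so
  this type is the ring of polynomials over the rationals in all the variables \<open>x\<^sub>F\<close>.
\<close>

type_synonym flat_poly = "(nat set \<Rightarrow>\<^sub>0 nat) \<Rightarrow>\<^sub>0 rat"

definition flat_var :: "nat set \<Rightarrow> flat_poly" where
  "flat_var F = Poly_Mapping.single (Poly_Mapping.single F 1) 1"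

definition flat_const :: "rat \<Rightarrow> flat_poly" where
  "flat_const c = Poly_Mapping.single 0 c"

text \<open>Every subset of the ground set is a flat of the boolean matroid.\<close>

definition proper_flats :: "nat \<Rightarrow> nat set set" where
  "proper_flats n = {F. {} \<subset> F \<and> F \<subset> {1..n}}"

definition flat_poly_ring :: "nat \<Rightarrow> flat_poly ring" where
  "flat_poly_ring n =
     \<lparr> carrier = {p. \<forall>m \<in> Poly_Mapping.keys p. Poly_Mapping.keys m \<subseteq> proper_flats n},
       monoid.mult = (*), one = 1, ring.zero = 0, add = (+) \<rparr>"

definition linear_ideal :: "nat \<Rightarrow> flat_poly set" where
  "linear_ideal n = Idl\<^bsub>flat_poly_ring n\<^esub>
     {(\<Sum>F\<in>{F \<in> proper_flats n. i \<notin> F}. flat_var F) -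
      (\<Sum>F\<in>{F \<in> proper_flats n. j \<notin> F}. flat_var F) | i j. i \<in> {1..n} \<and> j \<in> {1..n}}"

definition incomparable_ideal :: "nat \<Rightarrow> flat_poly set" where
  "incomparable_ideal n = Idl\<^bsub>flat_poly_ring n\<^esub>
     {flat_var F * flat_var F' | F F'.
        F \<in> proper_flats n \<and> F' \<in> proper_flats n \<and> \<not> F \<subseteq> F' \<and> \<not> F' \<subseteq> F}"

definition chow_ideal :: "nat \<Rightarrow> flat_poly set" where
  "chow_ideal n = linear_ideal n <+>\<^bsub>flat_poly_ring n\<^esub> incomparable_ideal n"

definition chow_ring :: "nat \<Rightarrow> flat_poly set ring" where
  "chow_ring n = flat_poly_ring n Quot chow_ideal n"

definition chow_class :: "nat \<Rightarrow> flat_poly \<Rightarrow> flat_poly set" where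
  "chow_class n p = chow_ideal n +>\<^bsub>flat_poly_ring n\<^esub> p"

definition homogeneous :: "nat \<Rightarrow> flat_poly \<Rightarrow> bool" where
  "homogeneous k p \<longleftrightarrow>
     (\<forall>m \<in> Poly_Mapping.keys p. (\<Sum>F\<in>Poly_Mapping.keys m. Poly_Mapping.lookup m F) = k)"

definition chow_graded_piece :: "nat \<Rightarrow> nat \<Rightarrow> flat_poly set set" where
  "chow_graded_piece n k = chow_class n ` {p \<in> carrier (flat_poly_ring n). homogeneous k p}"

text \<open>The copy of the rationals inside the Chow ring, over which dimensions are taken.\<close>

definition chow_scalars :: "nat \<Rightarrow> flat_poly set set" where
  "chow_scalars n = range (\<lambda>c. chow_class n (flat_const c))"

definition eulerian_number :: "nat \<Rightarrow> nat \<Rightarrow> nat" where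
  "eulerian_number n k = ring.dim (chow_ring n) (chow_scalars n) (chow_graded_piece n k)"

definition chow_hilbert_series :: "nat \<Rightarrow> int fps" where
  "chow_hilbert_series n = Abs_fps (\<lambda>k. int (eulerian_number n k))"

text \<open>
  The Hilbert series is a polynomial; the Eulerian polynomial is that polynomial,
  not a truncation of it.
\<close>

definition eulerian_poly :: "nat \<Rightarrow> int poly" where
  "eulerian_poly n = (THE p. fps_of_poly p = chow_hilbert_series n)"

end

theory Submission
  imports Defs
begin

text \<open>
  The Chow ring of the boolean matroid is the quotient of the Stanley-Reisner ring \<open>M\<close> of chains of
  proper flats by the linear forms \<open>theta n i\<close>, \<open>i = 2, \<dots>, n\<close>.  Its Hilbert series is determined
  by squeezing, which replaces a Groebner basis computation or a Poincare pairing by counting.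

  Upper bound (\<open>fy_monomials_span\<close>): with \<open>x\<^sub>E\<close>, for the whole ground set \<open>E\<close>, standing for minus
  the sum of the \<open>x\<^sub>F\<close> over the proper flats \<open>F\<close> with \<open>1 \<in> F\<close>, the linear relations say that for every \<open>i\<close> the sum of all
  \<open>x\<^sub>F\<close> with \<open>i \<in> F\<close> vanishes.  They imply \<open>x\<^sub>G (\<Sum>\<^sub>H\<^sub>\<supseteq>\<^sub>F x\<^sub>H)\<^sup>d = 0\<close> whenever \<open>G \<subset> F\<close> and
  \<open>d = card (F - G)\<close>, and this allows any monomial to be rewritten into the monomials of Feichtner and
  Yuzvinsky: those along a chain of flats in which every exponent is smaller than the
  gap of its flat over the previous one.

  Lower bound (\<open>card_proper_chain_monomials_le\<close>): if sets \<open>B\<^sub>k\<close> span the graded pieces of the Chow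
  ring, then the products of their elements with monomials in the \<open>n - 1\<close> linear forms span the
  graded pieces of \<open>M\<close>.  But \<open>M\<close> has the chain monomials as a basis, so their number is at
  most the coefficient of \<open>x\<^sup>k\<close> in \<open>(\<Sum>\<^sub>i card B\<^sub>i x\<^sup>i) / (1 - x)\<^sup>n\<^sup>-\<^sup>1\<close>.

  For the Feichtner-Yuzvinsky monomials the two counts agree
  (\<open>card_proper_chain_monomials_eq_iterated_sum\<close>), so no spanning set can be smaller, and the
  Eulerian polynomial is the generating polynomial of these monomials.  Counting them by their
  chains gives, with \<open>A(t) = \<Sum>\<^sub>n A\<^sub>n(x) t\<^sup>n / n!\<close>, the closed form
  \<open>A(t) (x - e\<^sup>(\<^sup>x\<^sup>-\<^sup>1\<^sup>)\<^sup>t) = x - 1\<close> (\<open>egf_eulerian\<close>).  The claimed identity is then an addition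
  formula: it compares the coefficients of \<open>u\<^sup>n v\<^sup>m\<close> in
  \<open>A(u + v) = A(u) A(v) + x (A(u) - 1) (A(v) - 1) A(u + v)\<close>, which after division by
  \<open>A(u) A(v) A(u + v)\<close> is a polynomial identity in \<open>e\<^sup>(\<^sup>x\<^sup>-\<^sup>1\<^sup>)\<^sup>u\<close> and \<open>e\<^sup>(\<^sup>x\<^sup>-\<^sup>1\<^sup>)\<^sup>v\<close>
  (\<open>eulerian_val_addition\<close>).
\<close>

section \<open>Monomials and polynomials in the flat variables\<close>

text \<open>
  Two instances matter: the total degree \<open>mdeg\<close>, where every variable has weight \<open>1\<close>, and
  \<open>weighted card\<close>, which strictly increases when a monomial is straightened.
\<close>

definition weighted :: "('a \<Rightarrow> nat) \<Rightarrow> ('a \<Rightarrow>\<^sub>0 nat) \<Rightarrow> nat" where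
  "weighted f m = (\<Sum>F\<in>Poly_Mapping.keys m. Poly_Mapping.lookup m F * f F)"

abbreviation mdeg :: "('a \<Rightarrow>\<^sub>0 nat) \<Rightarrow> nat" where
  "mdeg \<equiv> weighted (\<lambda>_. Suc 0)"

lemma weighted_superset:
  assumes "finite A" "Poly_Mapping.keys m \<subseteq> A"
  shows "weighted f m = (\<Sum>F\<in>A. Poly_Mapping.lookup m F * f F)"
  unfolding weighted_def using assms
  by (intro sum.mono_neutral_left) (auto simp: in_keys_iff)

lemma keys_add_nat:
  fixes m m' :: "'a \<Rightarrow>\<^sub>0 nat"
  shows "Poly_Mapping.keys (m + m') = Poly_Mapping.keys m \<union> Poly_Mapping.keys m'"
  by (auto simp: in_keys_iff lookup_add)

lemma weighted_add: "weighted f (m + m') = weighted f m + weighted f m'"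
proof -
  let ?A = "Poly_Mapping.keys m \<union> Poly_Mapping.keys m'"
  have "weighted f (m + m') = (\<Sum>F\<in>?A. Poly_Mapping.lookup (m + m') F * f F)"
    by (rule weighted_superset) (auto simp: keys_add_nat)
  also have "\<dots> = (\<Sum>F\<in>?A. Poly_Mapping.lookup m F * f F) + (\<Sum>F\<in>?A. Poly_Mapping.lookup m' F * f F)"
    by (simp add: lookup_add algebra_simps sum.distrib)
  also have "\<dots> = weighted f m + weighted f m'"
    by (simp add: weighted_superset[of ?A])
  finally show ?thesis .
qed

lemma weighted_single: "weighted f (Poly_Mapping.single F a) = a * f F"
  by (simp add: weighted_def)

lemma weighted_0: "weighted f 0 = 0"
  by (simp add: weighted_def)

lemma weighted_le:
  assumes "\<And>F. F \<in> Poly_Mapping.keys m \<Longrightarrow> f F \<le> c"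
  shows "weighted f m \<le> c * mdeg m"
proof -
  have "weighted f m \<le> (\<Sum>F\<in>Poly_Mapping.keys m. Poly_Mapping.lookup m F * c)"
    unfolding weighted_def using assms by (intro sum_mono mult_left_mono) auto
  also have "\<dots> = c * mdeg m"
    by (simp add: weighted_def sum_distrib_left mult.commute)
  finally show ?thesis .
qed

lemma homogeneous_alt: "homogeneous k p \<longleftrightarrow> (\<forall>m\<in>Poly_Mapping.keys p. mdeg m = k)"
  by (simp add: homogeneous_def weighted_def)

definition restrict_mons :: "((nat set \<Rightarrow>\<^sub>0 nat) \<Rightarrow> bool) \<Rightarrow> flat_poly \<Rightarrow> flat_poly" where
  "restrict_mons P p = Poly_Mapping.mapp (\<lambda>m c. if P m then c else 0) p"

lemma lookup_restrict_mons:
  "Poly_Mapping.lookup (restrict_mons P p) m = (if P m then Poly_Mapping.lookup p m else 0)"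
  by (auto simp: restrict_mons_def lookup_mapp when_def in_keys_iff)

lemma restrict_mons_0: "restrict_mons P 0 = 0"
  and restrict_mons_add: "restrict_mons P (p + q) = restrict_mons P p + restrict_mons P q"
  and restrict_mons_diff: "restrict_mons P (p - q) = restrict_mons P p - restrict_mons P q"
  by (auto intro!: poly_mapping_eqI simp: lookup_restrict_mons lookup_add lookup_minus)

lemma restrict_mons_sum: "restrict_mons P (\<Sum>i\<in>A. f i) = (\<Sum>i\<in>A. restrict_mons P (f i))"
  by (auto intro!: poly_mapping_eqI simp: lookup_restrict_mons lookup_sum)

lemma keys_restrict_mons: "Poly_Mapping.keys (restrict_mons P p) = {m \<in> Poly_Mapping.keys p. P m}"
  by (auto simp: in_keys_iff lookup_restrict_mons split: if_splits)

lemma restrict_mons_id: "(\<And>m. m \<in> Poly_Mapping.keys p \<Longrightarrow> P m) \<Longrightarrow> restrict_mons P p = p"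
  by (rule poly_mapping_eqI) (auto simp: lookup_restrict_mons in_keys_iff)

lemma restrict_mons_eq_0: "(\<And>m. m \<in> Poly_Mapping.keys p \<Longrightarrow> \<not> P m) \<Longrightarrow> restrict_mons P p = 0"
  by (rule poly_mapping_eqI) (auto simp: lookup_restrict_mons in_keys_iff)

lemma lookup_flat_const_mult: "Poly_Mapping.lookup (flat_const c * p) m = c * Poly_Mapping.lookup p m"
proof -
  have "flat_const c * p = Poly_Mapping.map ((*) c) p"
    by (simp add: flat_const_def mult_map_scale_conv_mult)
  then show ?thesis by (simp add: Poly_Mapping.map.rep_eq when_def)
qed

lemma restrict_mons_scale: "restrict_mons P (flat_const c * p) = flat_const c * restrict_mons P p"
  by (rule poly_mapping_eqI) (auto simp: lookup_restrict_mons lookup_flat_const_mult)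

lemma flat_const_simps:
  "flat_const 0 = 0" "flat_const 1 = 1"
  "flat_const (a + b) = flat_const a + flat_const b"
  "flat_const (a * b) = flat_const a * flat_const b"
  "flat_const (- a) = - flat_const a"
  by (auto simp: flat_const_def single_add mult_single single_uminus)

lemma flat_const_minus_1: "flat_const (- 1) * p = - p"
  unfolding flat_const_simps by simp

interpretation flat: vector_space "\<lambda>c p. flat_const c * p"
  by unfold_locales (auto simp: flat_const_simps algebra_simps)

lemma homogeneous_0: "homogeneous k 0"
  by (simp add: homogeneous_alt)

lemma homogeneous_add: "homogeneous k p \<Longrightarrow> homogeneous k q \<Longrightarrow> homogeneous k (p + q)"
  using keys_add[of p q] by (auto simp: homogeneous_alt)

lemma homogeneous_diff: "homogeneous k p \<Longrightarrow> homogeneous k q \<Longrightarrow> homogeneous k (p - q)"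
  using keys_diff[of p q] by (auto simp: homogeneous_alt)

lemma homogeneous_sum: "(\<And>i. i \<in> A \<Longrightarrow> homogeneous k (f i)) \<Longrightarrow> homogeneous k (\<Sum>i\<in>A. f i)"
  by (induction A rule: infinite_finite_induct) (auto simp: homogeneous_0 homogeneous_add)

lemma homogeneous_mult: "homogeneous k p \<Longrightarrow> homogeneous l q \<Longrightarrow> homogeneous (k + l) (p * q)"
  using keys_mult[of p q] by (fastforce simp: homogeneous_alt weighted_add)

lemma homogeneous_const: "homogeneous 0 (flat_const c)"
  by (auto simp: homogeneous_alt flat_const_def weighted_0)

lemma homogeneous_scale: "homogeneous k p \<Longrightarrow> homogeneous k (flat_const c * p)"
  using homogeneous_mult[OF homogeneous_const] by force

lemma homogeneous_power: "homogeneous k p \<Longrightarrow> homogeneous (a * k) (p ^ a)"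
proof (induction a)
  case 0 then show ?case using homogeneous_const[of 1] by (simp add: flat_const_simps)
next
  case (Suc a) then show ?case using homogeneous_mult[of k p "a * k" "p ^ a"] by simp
qed

lemma homogeneous_var: "homogeneous 1 (flat_var F)"
  by (auto simp: homogeneous_alt flat_var_def weighted_single)

lemma homogeneous_span: "p \<in> flat.span B \<Longrightarrow> (\<And>b. b \<in> B \<Longrightarrow> homogeneous k b) \<Longrightarrow> homogeneous k p"
  by (induction rule: flat.span_induct_alt)
     (auto simp: homogeneous_0 intro!: homogeneous_add homogeneous_scale)

lemma restrict_mons_span:
  assumes "p \<in> flat.span B"
  shows "restrict_mons P p \<in> flat.span (restrict_mons P ` B)"
  using assms
  by (induction rule: flat.span_induct_alt)
     (auto simp: restrict_mons_0 restrict_mons_add restrict_mons_scale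
       intro!: flat.span_zero flat.span_add flat.span_scale intro: flat.span_base)

lemma poly_eq_sum_monomials:
  "p = (\<Sum>m\<in>Poly_Mapping.keys p. flat_const (Poly_Mapping.lookup p m) * Poly_Mapping.single m 1)"
proof (rule poly_mapping_eqI)
  fix m
  show "Poly_Mapping.lookup p m = Poly_Mapping.lookup (\<Sum>m\<in>Poly_Mapping.keys p.
      flat_const (Poly_Mapping.lookup p m) * Poly_Mapping.single m 1) m"
    by (auto simp: lookup_sum lookup_flat_const_mult lookup_single when_def in_keys_iff
        if_distrib[of "(*) _"] cong: if_cong)
qed

lemma in_span_monomials:
  assumes "\<And>m. m \<in> Poly_Mapping.keys p \<Longrightarrow> Poly_Mapping.single m 1 \<in> flat.span B"
  shows "p \<in> flat.span B"
  by (subst poly_eq_sum_monomials) (intro flat.span_sum flat.span_scale assms)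

lemma independent_monomials: "flat.independent ((\<lambda>m. Poly_Mapping.single m 1) ` M)"
  unfolding flat.dependent_def
proof (safe, goal_cases)
  case (1 _ m)
  let ?e = "\<lambda>m. Poly_Mapping.single m 1 :: flat_poly"
  have "flat.span (?e ` M - {?e m}) \<subseteq> {p. Poly_Mapping.lookup p m = 0}"
    by (rule flat.span_minimal)
       (auto simp: flat.subspace_def lookup_add lookup_flat_const_mult lookup_single when_def)
  with 1 show ?case by (auto simp: subset_iff)
qed

section \<open>The Chow ideal and the generator of the top flat\<close>

definition flats :: "nat \<Rightarrow> nat set set" where
  "flats n = {F. F \<noteq> {} \<and> F \<subseteq> {1..n}}"

lemma finite_flats [simp]: "finite (flats n)"
  by (simp add: flats_def)

lemma proper_flats_alt: "proper_flats n = flats n - {{1..n}}"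
  by (auto simp: proper_flats_def flats_def)

lemma finite_proper_flats [simp]: "finite (proper_flats n)"
  by (simp add: proper_flats_alt)

lemma carrier_iff:
  "p \<in> carrier (flat_poly_ring n) \<longleftrightarrow> (\<forall>m\<in>Poly_Mapping.keys p. Poly_Mapping.keys m \<subseteq> proper_flats n)"
  by (simp add: flat_poly_ring_def)

lemma carrier_0: "0 \<in> carrier (flat_poly_ring n)"
  and carrier_1: "1 \<in> carrier (flat_poly_ring n)"
  and carrier_const: "flat_const c \<in> carrier (flat_poly_ring n)"
  and carrier_var: "F \<in> proper_flats n \<Longrightarrow> flat_var F \<in> carrier (flat_poly_ring n)"
  by (auto simp: carrier_iff flat_const_def flat_var_def)

lemma carrier_uminus: "p \<in> carrier (flat_poly_ring n) \<Longrightarrow> - p \<in> carrier (flat_poly_ring n)"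
  by (auto simp: carrier_iff in_keys_iff)

lemma carrier_add:
  assumes "p \<in> carrier (flat_poly_ring n)" "q \<in> carrier (flat_poly_ring n)"
  shows "p + q \<in> carrier (flat_poly_ring n)"
  using assms keys_add[of p q] unfolding carrier_iff by blast

lemma carrier_mult:
  assumes "p \<in> carrier (flat_poly_ring n)" "q \<in> carrier (flat_poly_ring n)"
  shows "p * q \<in> carrier (flat_poly_ring n)"
  using assms keys_mult[of p q] unfolding carrier_iff by (fastforce simp: keys_add_nat)

lemma carrier_diff:
  assumes "p \<in> carrier (flat_poly_ring n)" "q \<in> carrier (flat_poly_ring n)"
  shows "p - q \<in> carrier (flat_poly_ring n)"
  using carrier_add[OF assms(1) carrier_uminus[OF assms(2)]] by simp

lemma carrier_sum:
  "(\<And>i. i \<in> A \<Longrightarrow> f i \<in> carrier (flat_poly_ring n)) \<Longrightarrow> (\<Sum>i\<in>A. f i) \<in> carrier (flat_poly_ring n)"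
  by (induction A rule: infinite_finite_induct) (auto simp: carrier_0 carrier_add)

lemma carrier_prod:
  "(\<And>i. i \<in> A \<Longrightarrow> f i \<in> carrier (flat_poly_ring n)) \<Longrightarrow> (\<Prod>i\<in>A. f i) \<in> carrier (flat_poly_ring n)"
  by (induction A rule: infinite_finite_induct) (auto simp: carrier_1 carrier_mult)

lemma carrier_power:
  "p \<in> carrier (flat_poly_ring n) \<Longrightarrow> p ^ a \<in> carrier (flat_poly_ring n)"
  by (induction a) (auto simp: carrier_1 carrier_mult)

lemmas carrier_intros = carrier_0 carrier_1 carrier_const carrier_var carrier_uminus carrier_add
  carrier_mult carrier_diff carrier_sum carrier_prod carrier_power

lemma carrier_span:
  "p \<in> flat.span B \<Longrightarrow> B \<subseteq> carrier (flat_poly_ring n) \<Longrightarrow> p \<in> carrier (flat_poly_ring n)"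
  by (induction rule: flat.span_induct_alt) (auto intro!: carrier_intros)

lemma carrier_restrict_mons:
  "p \<in> carrier (flat_poly_ring n) \<Longrightarrow> restrict_mons P p \<in> carrier (flat_poly_ring n)"
  by (auto simp: carrier_iff keys_restrict_mons)

lemma flat_poly_ring_ops:
  "p \<oplus>\<^bsub>flat_poly_ring n\<^esub> q = p + q" "p \<otimes>\<^bsub>flat_poly_ring n\<^esub> q = p * q"
  "\<zero>\<^bsub>flat_poly_ring n\<^esub> = 0" "\<one>\<^bsub>flat_poly_ring n\<^esub> = 1"
  by (simp_all add: flat_poly_ring_def)

lemma cring_flat_poly_ring: "cring (flat_poly_ring n)"
proof (intro cringI abelian_groupI comm_monoidI)
  fix p assume "p \<in> carrier (flat_poly_ring n)"
  then show "\<exists>q\<in>carrier (flat_poly_ring n). q \<oplus>\<^bsub>flat_poly_ring n\<^esub> p = \<zero>\<^bsub>flat_poly_ring n\<^esub>"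
    by (intro bexI[of _ "- p"]) (auto simp: flat_poly_ring_ops carrier_uminus)
qed (auto simp: flat_poly_ring_ops carrier_intros algebra_simps)

lemma flat_poly_ring_uminus:
  assumes "p \<in> carrier (flat_poly_ring n)"
  shows "\<ominus>\<^bsub>flat_poly_ring n\<^esub> p = - p"
proof -
  interpret cring "flat_poly_ring n" by (rule cring_flat_poly_ring)
  show ?thesis using assms minus_equality[of "- p" p]
    by (auto simp: flat_poly_ring_ops carrier_uminus)
qed

definition avoiding_sum :: "nat \<Rightarrow> nat \<Rightarrow> flat_poly" where
  "avoiding_sum n i = (\<Sum>F\<in>{F \<in> proper_flats n. i \<notin> F}. flat_var F)"

lemma carrier_avoiding_sum: "avoiding_sum n i \<in> carrier (flat_poly_ring n)"
  by (auto simp: avoiding_sum_def intro!: carrier_intros)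

lemma homogeneous_avoiding_sum: "homogeneous 1 (avoiding_sum n i)"
  unfolding avoiding_sum_def by (intro homogeneous_sum homogeneous_var)

lemma ideal_linear_ideal: "ideal (linear_ideal n) (flat_poly_ring n)"
  unfolding linear_ideal_def avoiding_sum_def[symmetric]
  by (intro ring.genideal_ideal cring.axioms cring_flat_poly_ring)
     (auto intro!: carrier_intros carrier_avoiding_sum)

lemma ideal_incomparable_ideal: "ideal (incomparable_ideal n) (flat_poly_ring n)"
  unfolding incomparable_ideal_def
  by (intro ring.genideal_ideal cring.axioms cring_flat_poly_ring) (auto intro!: carrier_intros)

lemma ideal_chow_ideal: "ideal (chow_ideal n) (flat_poly_ring n)"
  unfolding chow_ideal_def
  by (intro ring.add_ideals cring.axioms cring_flat_poly_ring ideal_linear_ideal ideal_incomparable_ideal)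

lemma in_chow_ideal_iff:
  "z \<in> chow_ideal n \<longleftrightarrow> (\<exists>u\<in>linear_ideal n. \<exists>v\<in>incomparable_ideal n. z = u + v)"
  by (auto simp: chow_ideal_def set_add_def' flat_poly_ring_ops)

lemma ideal_closures:
  assumes "ideal N (flat_poly_ring n)"
  shows "z \<in> N \<Longrightarrow> z \<in> carrier (flat_poly_ring n)" "0 \<in> N"
    "z \<in> N \<Longrightarrow> z' \<in> N \<Longrightarrow> z + z' \<in> N"
    "z \<in> N \<Longrightarrow> p \<in> carrier (flat_poly_ring n) \<Longrightarrow> p * z \<in> N"
proof -
  interpret ideal N "flat_poly_ring n" by fact
  show "z \<in> N \<Longrightarrow> z \<in> carrier (flat_poly_ring n)" "0 \<in> N"
    "z \<in> N \<Longrightarrow> z' \<in> N \<Longrightarrow> z + z' \<in> N"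
    "z \<in> N \<Longrightarrow> p \<in> carrier (flat_poly_ring n) \<Longrightarrow> p * z \<in> N"
    using a_Hcarr additive_subgroup.a_closed[OF additive_subgroup_axioms, of z z'] I_l_closed[of z p]
      additive_subgroup.zero_closed[OF additive_subgroup_axioms]
    by (auto simp: flat_poly_ring_ops)
qed

lemmas chow_ideal_carrier = ideal_closures(1)[OF ideal_chow_ideal]
  and chow_ideal_0 = ideal_closures(2)[OF ideal_chow_ideal]
  and chow_ideal_add = ideal_closures(3)[OF ideal_chow_ideal]
  and chow_ideal_mult = ideal_closures(4)[OF ideal_chow_ideal]

lemma chow_ideal_mult': 
  "z \<in> chow_ideal n \<Longrightarrow> p \<in> carrier (flat_poly_ring n) \<Longrightarrow> z * p \<in> chow_ideal n"
  using chow_ideal_mult[of z n p] by (simp add: mult.commute)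

lemma chow_ideal_uminus: "z \<in> chow_ideal n \<Longrightarrow> - z \<in> chow_ideal n"
  using chow_ideal_mult[of z n "- 1"] by (simp add: carrier_uminus carrier_1)

lemma chow_ideal_diff: "z \<in> chow_ideal n \<Longrightarrow> z' \<in> chow_ideal n \<Longrightarrow> z - z' \<in> chow_ideal n"
  using chow_ideal_add[of z n "- z'"] chow_ideal_uminus[of z' n] by simp

lemma chow_ideal_sum:
  "(\<And>i. i \<in> A \<Longrightarrow> f i \<in> chow_ideal n) \<Longrightarrow> (\<Sum>i\<in>A. f i) \<in> chow_ideal n"
  by (induction A rule: infinite_finite_induct) (auto simp: chow_ideal_0 chow_ideal_add)

lemma linear_gen_in_chow_ideal:
  assumes "i \<in> {1..n}" "j \<in> {1..n}"
  shows "avoiding_sum n i - avoiding_sum n j \<in> chow_ideal n"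
proof -
  have "avoiding_sum n i - avoiding_sum n j \<in> linear_ideal n"
    unfolding linear_ideal_def avoiding_sum_def[symmetric]
    by (rule subsetD[OF ring.genideal_self])
       (use assms in \<open>auto intro!: cring.axioms cring_flat_poly_ring carrier_intros carrier_avoiding_sum\<close>)
  then show ?thesis
    using ideal_closures(2)[OF ideal_incomparable_ideal, of n] by (force simp: in_chow_ideal_iff)
qed

lemma incomparable_gen_in_chow_ideal:
  assumes "F \<in> proper_flats n" "G \<in> proper_flats n" "\<not> F \<subseteq> G" "\<not> G \<subseteq> F"
  shows "flat_var F * flat_var G \<in> chow_ideal n"
proof -
  have "flat_var F * flat_var G \<in> incomparable_ideal n"
    unfolding incomparable_ideal_def
    by (rule subsetD[OF ring.genideal_self])
       (use assms in \<open>auto intro!: cring.axioms cring_flat_poly_ring carrier_intros\<close>)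
  then show ?thesis
    using ideal_closures(2)[OF ideal_linear_ideal, of n] by (force simp: in_chow_ideal_iff)
qed

lemma chow_ideal_minimal:
  assumes N: "ideal N (flat_poly_ring n)"
    and linear: "\<And>i j. i \<in> {1..n} \<Longrightarrow> j \<in> {1..n} \<Longrightarrow> avoiding_sum n i - avoiding_sum n j \<in> N"
    and incomp: "\<And>F G. F \<in> proper_flats n \<Longrightarrow> G \<in> proper_flats n \<Longrightarrow> \<not> F \<subseteq> G \<Longrightarrow> \<not> G \<subseteq> F \<Longrightarrow>
      flat_var F * flat_var G \<in> N"
  shows "chow_ideal n \<subseteq> N"
proof -
  interpret cring "flat_poly_ring n" by (rule cring_flat_poly_ring)
  have "linear_ideal n \<subseteq> N"
    unfolding linear_ideal_def avoiding_sum_def[symmetric]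
    by (rule genideal_minimal[OF N]) (use linear in blast)
  moreover have "incomparable_ideal n \<subseteq> N"
    unfolding incomparable_ideal_def
    by (rule genideal_minimal[OF N]) (use incomp in blast)
  ultimately show ?thesis
    by (auto simp: in_chow_ideal_iff intro!: ideal_closures(3)[OF N])
qed

text \<open>
  The image of the variable \<open>x\<^sub>E\<close> of the presentation with \<open>x\<^sub>E\<close>, \<open>E = {1..n}\<close>, as an additional generator.
  Any other element of \<open>E\<close> could take the place of \<open>1\<close> without changing the class modulo the Chow ideal.
\<close>

definition flat_gen :: "nat \<Rightarrow> nat set \<Rightarrow> flat_poly" where
  "flat_gen n F = (if F = {1..n} then - (\<Sum>G\<in>{G \<in> proper_flats n. 1 \<in> G}. flat_var G) else flat_var F)"

lemma carrier_flat_gen: "F \<in> flats n \<Longrightarrow> flat_gen n F \<in> carrier (flat_poly_ring n)"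
  by (auto simp: flat_gen_def proper_flats_alt intro!: carrier_intros)

lemma homogeneous_flat_gen: "homogeneous 1 (flat_gen n F)"
proof -
  have "homogeneous 1 (0 - (\<Sum>G\<in>{G \<in> proper_flats n. 1 \<in> G}. flat_var G))"
    by (intro homogeneous_diff homogeneous_0 homogeneous_sum homogeneous_var)
  then show ?thesis using homogeneous_var[of F] by (simp add: flat_gen_def)
qed

text \<open>
  The sum of the proper variables \<open>x\<^sub>F\<close> with \<open>i \<in> F\<close> differs from minus \<open>avoiding_sum n i\<close> by an amount
  that does not depend on \<open>i\<close>, and \<open>x\<^sub>E\<close> cancels the instance \<open>i = 1\<close>.  So the sum in question is a
  generator of the linear ideal.
\<close>

lemma sum_flat_gen_containing:
  assumes i: "i \<in> {1..n}"
  shows "(\<Sum>F\<in>{F \<in> flats n. i \<in> F}. flat_gen n F) \<in> chow_ideal n"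
proof -
  have *: "(\<Sum>F\<in>{F \<in> proper_flats n. j \<in> F}. flat_var F) =
      (\<Sum>F\<in>proper_flats n. flat_var F) - avoiding_sum n j" for j
  proof -
    have "proper_flats n = {F \<in> proper_flats n. j \<in> F} \<union> {F \<in> proper_flats n. j \<notin> F}" by auto
    then have "(\<Sum>F\<in>proper_flats n. flat_var F) =
      (\<Sum>F\<in>{F \<in> proper_flats n. j \<in> F}. flat_var F) + avoiding_sum n j"
      unfolding avoiding_sum_def by (subst sum.union_disjoint[symmetric]) auto
    then show ?thesis by simp
  qed
  have eq: "{F \<in> flats n. i \<in> F} = insert {1..n} {F \<in> proper_flats n. i \<in> F}"
    using i by (auto simp: proper_flats_alt flats_def)
  have "(\<Sum>F\<in>{F \<in> flats n. i \<in> F}. flat_gen n F) =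
      flat_gen n {1..n} + (\<Sum>F\<in>{F \<in> proper_flats n. i \<in> F}. flat_gen n F)"
    unfolding eq by (subst sum.insert) (auto simp: proper_flats_alt)
  also have "(\<Sum>F\<in>{F \<in> proper_flats n. i \<in> F}. flat_gen n F) =
      (\<Sum>F\<in>{F \<in> proper_flats n. i \<in> F}. flat_var F)"
    by (intro sum.cong) (auto simp: flat_gen_def proper_flats_alt)
  also have "flat_gen n {1..n} + \<dots> = avoiding_sum n 1 - avoiding_sum n i"
    unfolding * by (simp add: flat_gen_def *)
  also have "\<dots> \<in> chow_ideal n"
    by (rule linear_gen_in_chow_ideal) (use i in auto)
  finally show ?thesis .
qed

lemma incomparable_flat_gen:
  assumes "F \<in> flats n" "G \<in> flats n" "\<not> F \<subseteq> G" "\<not> G \<subseteq> F"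
  shows "flat_gen n F * flat_gen n G \<in> chow_ideal n"
proof -
  have "F \<noteq> {1..n}" "G \<noteq> {1..n}" using assms by (auto simp: flats_def)
  then show ?thesis
    using assms incomparable_gen_in_chow_ideal[of F n G] by (auto simp: flat_gen_def proper_flats_alt)
qed

definition monom_eval :: "nat \<Rightarrow> (nat set \<Rightarrow>\<^sub>0 nat) \<Rightarrow> flat_poly" where
  "monom_eval n m = (\<Prod>F\<in>Poly_Mapping.keys m. flat_gen n F ^ Poly_Mapping.lookup m F)"

lemma monom_eval_0: "monom_eval n 0 = 1"
  by (simp add: monom_eval_def)

lemma monom_eval_single: "monom_eval n (Poly_Mapping.single F a) = flat_gen n F ^ a"
  by (simp add: monom_eval_def)

lemma monom_eval_superset:
  assumes "finite A" "Poly_Mapping.keys m \<subseteq> A"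
  shows "monom_eval n m = (\<Prod>F\<in>A. flat_gen n F ^ Poly_Mapping.lookup m F)"
  unfolding monom_eval_def using assms
  by (intro prod.mono_neutral_left) (auto simp: in_keys_iff)

lemma monom_eval_add: "monom_eval n (m + m') = monom_eval n m * monom_eval n m'"
proof -
  let ?A = "Poly_Mapping.keys m \<union> Poly_Mapping.keys m'"
  have "monom_eval n (m + m') = (\<Prod>F\<in>?A. flat_gen n F ^ Poly_Mapping.lookup (m + m') F)"
    by (rule monom_eval_superset) (auto simp: keys_add_nat)
  also have "\<dots> = (\<Prod>F\<in>?A. flat_gen n F ^ Poly_Mapping.lookup m F) *
      (\<Prod>F\<in>?A. flat_gen n F ^ Poly_Mapping.lookup m' F)"
    by (simp add: lookup_add power_add prod.distrib)
  also have "\<dots> = monom_eval n m * monom_eval n m'"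
    by (simp add: monom_eval_superset[of ?A])
  finally show ?thesis .
qed

lemma carrier_monom_eval:
  "Poly_Mapping.keys m \<subseteq> flats n \<Longrightarrow> monom_eval n m \<in> carrier (flat_poly_ring n)"
  unfolding monom_eval_def by (intro carrier_intros carrier_flat_gen) auto

lemma homogeneous_monom_eval: "homogeneous (mdeg m) (monom_eval n m)"
proof -
  have "homogeneous (\<Sum>F\<in>A. Poly_Mapping.lookup m F) (\<Prod>F\<in>A. flat_gen n F ^ Poly_Mapping.lookup m F)"
    if "finite A" for A
    using that
  proof (induction A)
    case empty
    then show ?case using homogeneous_const[of 1] by (simp add: flat_const_simps)
  next
    case (insert F A)
    then show ?case
      using homogeneous_mult[OF homogeneous_power[OF homogeneous_flat_gen]] by force
  qed
  from this[of "Poly_Mapping.keys m"] show ?thesis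
    by (simp add: monom_eval_def weighted_def)
qed

lemma monom_decompose: "(\<Sum>F\<in>Poly_Mapping.keys m. Poly_Mapping.single F (Poly_Mapping.lookup m F)) = m"
  by (rule poly_mapping_eqI) (auto simp: lookup_sum lookup_single when_def in_keys_iff cong: if_cong)

lemma monom_eval_proper:
  assumes "Poly_Mapping.keys m \<subseteq> proper_flats n"
  shows "monom_eval n m = Poly_Mapping.single m 1"
proof -
  have pw: "flat_var F ^ a = Poly_Mapping.single (Poly_Mapping.single F a) 1" for F a
    by (induction a) (auto simp: flat_var_def mult_single single_add[symmetric])
  have "monom_eval n m =
      (\<Prod>F\<in>Poly_Mapping.keys m. Poly_Mapping.single (Poly_Mapping.single F (Poly_Mapping.lookup m F)) 1)"
    unfolding monom_eval_def using assms
    by (intro prod.cong) (auto simp: flat_gen_def pw proper_flats_alt)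
  also have "\<dots> = Poly_Mapping.single (\<Sum>F\<in>Poly_Mapping.keys m. Poly_Mapping.single F (Poly_Mapping.lookup m F)) 1"
  proof -
    have "(\<Prod>F\<in>A. Poly_Mapping.single (g F) (1::rat)) = Poly_Mapping.single (\<Sum>F\<in>A. g F) 1"
      if "finite A" for A and g :: "nat set \<Rightarrow> nat set \<Rightarrow>\<^sub>0 nat"
      using that by induction (auto simp: mult_single)
    then show ?thesis by simp
  qed
  finally show ?thesis by (simp add: monom_decompose)
qed

section \<open>Straightening modulo the Chow ideal\<close>

definition congruent_span :: "nat \<Rightarrow> flat_poly set \<Rightarrow> flat_poly set" where
  "congruent_span n B = {p. \<exists>s\<in>flat.span B. p - s \<in> chow_ideal n}"

lemma congruent_span_ideal: "p \<in> chow_ideal n \<Longrightarrow> p \<in> congruent_span n B"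
  by (auto simp: congruent_span_def intro!: bexI[of _ 0] flat.span_zero)

lemma congruent_span_base: "p \<in> B \<Longrightarrow> p \<in> congruent_span n B"
  by (auto simp: congruent_span_def chow_ideal_0 intro!: bexI[of _ p] flat.span_base)

lemma congruent_span_add:
  assumes "p \<in> congruent_span n B" "q \<in> congruent_span n B"
  shows "p + q \<in> congruent_span n B"
proof -
  obtain s t where st: "s \<in> flat.span B" "p - s \<in> chow_ideal n" "t \<in> flat.span B" "q - t \<in> chow_ideal n"
    using assms by (auto simp: congruent_span_def)
  have "p + q - (s + t) \<in> chow_ideal n"
    using chow_ideal_add[OF st(2,4)] by (simp add: algebra_simps)
  then show ?thesis using st by (auto simp: congruent_span_def intro: flat.span_add)
qed

lemma congruent_span_scale:
  assumes "p \<in> congruent_span n B"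
  shows "flat_const c * p \<in> congruent_span n B"
proof -
  obtain s where s: "s \<in> flat.span B" "p - s \<in> chow_ideal n"
    using assms by (auto simp: congruent_span_def)
  have "flat_const c * p - flat_const c * s \<in> chow_ideal n"
    using chow_ideal_mult[OF s(2) carrier_const] by (simp add: algebra_simps)
  then show ?thesis using s by (auto simp: congruent_span_def intro: flat.span_scale)
qed

lemma congruent_span_span:
  "p \<in> flat.span C \<Longrightarrow> C \<subseteq> congruent_span n B \<Longrightarrow> p \<in> congruent_span n B"
  by (induction rule: flat.span_induct_alt)
     (auto intro!: congruent_span_add congruent_span_scale intro: congruent_span_ideal chow_ideal_0)

lemma congruent_span_cong:
  "p - q \<in> chow_ideal n \<Longrightarrow> q \<in> congruent_span n B \<Longrightarrow> p \<in> congruent_span n B"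
  using congruent_span_add[OF congruent_span_ideal, of "p - q" n q B] by simp

definition upper_sum :: "nat \<Rightarrow> nat set \<Rightarrow> flat_poly" where
  "upper_sum n F = (\<Sum>H\<in>{H \<in> flats n. F \<subseteq> H}. flat_gen n H)"

text \<open>
  The convention \<open>x\<^sub>\<emptyset> = 1\<close> lets the first flat of a chain be treated like the others, with the
  empty set as its predecessor.
\<close>

definition flat_gen0 :: "nat \<Rightarrow> nat set \<Rightarrow> flat_poly" where
  "flat_gen0 n G = (if G = {} then 1 else flat_gen n G)"

lemma carrier_upper_sum: "upper_sum n F \<in> carrier (flat_poly_ring n)"
  by (auto simp: upper_sum_def intro!: carrier_intros carrier_flat_gen)

lemma carrier_flat_gen0: "G \<subseteq> {1..n} \<Longrightarrow> flat_gen0 n G \<in> carrier (flat_poly_ring n)"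
  by (auto simp: flat_gen0_def carrier_1 flats_def intro!: carrier_flat_gen)

lemma incomparable_flat_gen0:
  assumes "F \<subseteq> {1..n}" "G \<subseteq> {1..n}" "\<not> F \<subseteq> G" "\<not> G \<subseteq> F"
  shows "flat_gen0 n F * flat_gen0 n G \<in> chow_ideal n"
  using assms incomparable_flat_gen[of F n G] by (auto simp: flat_gen0_def flats_def)

text \<open>
  Only flats comparable to \<open>H\<close> survive multiplication by \<open>x\<^sub>H\<close>, and a flat containing \<open>F\<close> cannot lie below
  \<open>H\<close>.
\<close>

lemma flat_gen_times_upper_sum:
  assumes "H \<in> flats n" "\<not> F \<subseteq> H"
  shows "flat_gen n H * upper_sum n F - flat_gen n H * upper_sum n (F \<union> H) \<in> chow_ideal n"
proof -
  have "{K \<in> flats n. F \<subseteq> K} = {K \<in> flats n. F \<union> H \<subseteq> K} \<union> {K \<in> flats n. F \<subseteq> K \<and> \<not> H \<subseteq> K}" by auto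
  then have "upper_sum n F = upper_sum n (F \<union> H) + (\<Sum>K\<in>{K \<in> flats n. F \<subseteq> K \<and> \<not> H \<subseteq> K}. flat_gen n K)"
    unfolding upper_sum_def by (subst sum.union_disjoint[symmetric]) auto
  then have "flat_gen n H * upper_sum n F - flat_gen n H * upper_sum n (F \<union> H) =
      (\<Sum>K\<in>{K \<in> flats n. F \<subseteq> K \<and> \<not> H \<subseteq> K}. flat_gen n H * flat_gen n K)"
    by (simp add: algebra_simps sum_distrib_left)
  also have "\<dots> \<in> chow_ideal n"
    by (intro chow_ideal_sum incomparable_flat_gen) (use assms in auto)
  finally show ?thesis .
qed

lemma flat_gen_times_upper_sum_power:
  assumes "H \<in> flats n" "\<not> F \<subseteq> H"
  shows "flat_gen n H * upper_sum n F ^ a - flat_gen n H * upper_sum n (F \<union> H) ^ a \<in> chow_ideal n"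
proof (induction a)
  case 0
  then show ?case by (simp add: chow_ideal_0)
next
  case (Suc a)
  let ?x = "flat_gen n H" and ?u = "upper_sum n F" and ?v = "upper_sum n (F \<union> H)"
  have "?x * ?u ^ Suc a - ?x * ?v ^ Suc a = (?x * ?u ^ a - ?x * ?v ^ a) * ?u + (?x * ?u - ?x * ?v) * ?v ^ a"
    by (simp add: algebra_simps)
  also have "\<dots> \<in> chow_ideal n"
    by (intro chow_ideal_add chow_ideal_mult' Suc.IH flat_gen_times_upper_sum assms
        carrier_upper_sum carrier_intros)
  finally show ?case .
qed

text \<open>
  Induction on the exponent.  For \<open>i \<in> F - G\<close> the sum of all \<open>x\<^sub>H\<close> with \<open>i \<in> H\<close> lies in the ideal, so one factor
  \<open>\<Sum>\<^sub>H\<^sub>\<supseteq>\<^sub>F x\<^sub>H\<close> may be replaced by minus the sum of the \<open>x\<^sub>H\<close> with \<open>i \<in> H\<close> and \<open>\<not> F \<subseteq> H\<close>.  Multiplied by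
  \<open>x\<^sub>G\<close>, such an \<open>x\<^sub>H\<close> survives only if \<open>G \<subset> H\<close>; then the remaining factors become sums over the flats above
  \<open>F \<union> H\<close>, and the gap \<open>(F \<union> H) - H\<close> is smaller than \<open>F - G\<close> because it misses \<open>i\<close>.
\<close>

lemma upper_sum_power_vanishes:
  assumes "G \<subset> F" "F \<subseteq> {1..n}" "card (F - G) \<le> d"
  shows "flat_gen0 n G * upper_sum n F ^ d \<in> chow_ideal n"
  using assms
proof (induction d arbitrary: F G)
  case 0
  have "finite (F - G)" "F - G \<noteq> {}" using 0 finite_subset[of F "{1..n}"] by auto
  then have "card (F - G) \<noteq> 0" by (simp only: card_eq_0_iff) simp
  then show ?case using 0 by simp
next
  case (Suc d)
  have fin: "finite F" using Suc.prems finite_subset by auto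
  \<comment> \<open>In each of the terms below, the element i makes the gap shrink.\<close>
  obtain i where i: "i \<in> F" "i \<notin> G" using Suc.prems by auto
  have i': "i \<in> {1..n}" and G: "G \<subseteq> {1..n}" using i Suc.prems by auto
  let ?x = "flat_gen0 n G" and ?u = "upper_sum n F"
  let ?S = "\<Sum>H\<in>{H \<in> flats n. i \<in> H}. flat_gen n H"
  let ?A = "{H \<in> flats n. i \<in> H \<and> \<not> F \<subseteq> H}"
  have "{H \<in> flats n. i \<in> H} = {H \<in> flats n. F \<subseteq> H} \<union> ?A" using i by blast
  then have "?S = sum (flat_gen n) ({H \<in> flats n. F \<subseteq> H} \<union> ?A)" by (rule arg_cong)
  also have "\<dots> = ?u + (\<Sum>H\<in>?A. flat_gen n H)"
    unfolding upper_sum_def by (rule sum.union_disjoint) auto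
  finally have u: "?u = ?S - (\<Sum>H\<in>?A. flat_gen n H)"
    unfolding eq_diff_eq by (rule sym)
  have eq: "?x * ?u ^ Suc d = (?x * ?u ^ d) * ?S - (\<Sum>H\<in>?A. ?x * (flat_gen n H * ?u ^ d))"
  proof -
    have "?x * ?u ^ Suc d = (?x * ?u ^ d) * ?u" by (simp add: algebra_simps)
    also have "\<dots> = (?x * ?u ^ d) * ?S - (?x * ?u ^ d) * (\<Sum>H\<in>?A. flat_gen n H)"
      by (subst u) (rule right_diff_distrib)
    also have "(?x * ?u ^ d) * (\<Sum>H\<in>?A. flat_gen n H) = (\<Sum>H\<in>?A. ?x * (flat_gen n H * ?u ^ d))"
      by (simp add: sum_distrib_left mult_ac)
    finally show ?thesis .
  qed
  have S: "(?x * ?u ^ d) * ?S \<in> chow_ideal n"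
    by (intro chow_ideal_mult sum_flat_gen_containing[OF i'] carrier_intros carrier_flat_gen0[OF G] carrier_upper_sum)
  have A: "?x * (flat_gen n H * ?u ^ d) \<in> chow_ideal n" if H: "H \<in> ?A" for H
  proof (cases "G \<subseteq> H")
    case False
    have H': "H \<subseteq> {1..n}" "H \<noteq> {}" "\<not> H \<subseteq> G" using H i by (auto simp: flats_def)
    have "(?x * flat_gen0 n H) * ?u ^ d \<in> chow_ideal n"
      by (intro chow_ideal_mult' incomparable_flat_gen0 G H' False carrier_intros carrier_upper_sum)
    then show ?thesis using H' by (simp add: flat_gen0_def mult_ac)
  next
    case True
    have H': "H \<in> flats n" "H \<subseteq> {1..n}" "H \<noteq> {}" "\<not> F \<subseteq> H" using H by (auto simp: flats_def)
    have "F \<union> H - H \<subset> F - G" using True H i by auto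
    then have "card (F \<union> H - H) < card (F - G)" by (intro psubset_card_mono) (use fin in auto)
    then have "flat_gen0 n H * upper_sum n (F \<union> H) ^ d \<in> chow_ideal n"
      by (intro Suc.IH) (use H' Suc.prems in auto)
    then have "flat_gen n H * upper_sum n (F \<union> H) ^ d \<in> chow_ideal n"
      using H' by (simp add: flat_gen0_def)
    from chow_ideal_add[OF flat_gen_times_upper_sum_power[OF H'(1,4), of d] this]
    have "flat_gen n H * ?u ^ d \<in> chow_ideal n" by simp
    then show ?thesis by (rule chow_ideal_mult) (rule carrier_flat_gen0[OF G])
  qed
  show ?case unfolding eq by (intro chow_ideal_diff S chow_ideal_sum A)
qed

text \<open>
  The leading term of the power is \<open>x\<^sub>F\<^sup>d\<close>; in all other terms some factor \<open>x\<^sub>F\<close> is replaced by the variable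
  of a larger flat, which raises the cardinality weight.
\<close>

lemma upper_sum_power_expand:
  assumes F: "F \<in> flats n"
  shows "upper_sum n F ^ d - flat_gen n F ^ d \<in> flat.span (monom_eval n `
    {m. Poly_Mapping.keys m \<subseteq> flats n \<and> mdeg m = d \<and> d * card F < weighted card m})"
proof (induction d)
  case 0
  then show ?case by (simp add: flat.span_zero)
next
  case (Suc d)
  let ?M = "\<lambda>d. {m. Poly_Mapping.keys m \<subseteq> flats n \<and> mdeg m = d \<and> d * card F < weighted card m}"
  let ?x = "flat_gen n F" and ?A = "{H \<in> flats n. F \<subset> H}"
  define u where "u = upper_sum n F ^ d - ?x ^ d"
  have card: "card F < card H" if "H \<in> ?A" for H
    using that by (intro psubset_card_mono) (auto simp: flats_def intro: finite_subset)
  have "{H \<in> flats n. F \<subseteq> H} = insert F ?A" using F by auto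
  then have up: "upper_sum n F = ?x + (\<Sum>H\<in>?A. flat_gen n H)"
    by (simp add: upper_sum_def)
  have step: "p * flat_gen n H \<in> flat.span (monom_eval n ` ?M (Suc d))"
    if p: "p \<in> flat.span (monom_eval n ` N)" and H: "H \<in> flats n"
      and N: "\<And>m. m \<in> N \<Longrightarrow> m + Poly_Mapping.single H 1 \<in> ?M (Suc d)" for p H N
    using p
  proof (induction rule: flat.span_induct_alt)
    case base
    then show ?case by (simp add: flat.span_zero)
  next
    case (step c b q)
    then obtain m where m: "m \<in> N" "b = monom_eval n m" by auto
    have "b * flat_gen n H = monom_eval n (m + Poly_Mapping.single H 1)"
      by (simp add: m monom_eval_add monom_eval_single)
    then have "b * flat_gen n H \<in> flat.span (monom_eval n ` ?M (Suc d))"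
      using N[OF m(1)] by (intro flat.span_base) auto
    from flat.span_add[OF flat.span_scale[OF this, of c] step.IH] show ?case
      by (simp add: algebra_simps)
  qed
  have xd: "?x ^ d \<in> flat.span (monom_eval n ` {Poly_Mapping.single F d})"
    by (intro flat.span_base) (simp add: monom_eval_single)
  have "upper_sum n F ^ Suc d - ?x ^ Suc d =
      u * ?x + (\<Sum>H\<in>?A. u * flat_gen n H) + (\<Sum>H\<in>?A. ?x ^ d * flat_gen n H)"
  proof -
    have "upper_sum n F ^ Suc d = (?x ^ d + u) * upper_sum n F" by (simp add: u_def mult.commute)
    also have "\<dots> = (?x ^ d + u) * (?x + (\<Sum>H\<in>?A. flat_gen n H))" by (simp only: up)
    finally show ?thesis
      unfolding sum_distrib_left[symmetric] by (simp add: algebra_simps)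
  qed
  also have "\<dots> \<in> flat.span (monom_eval n ` ?M (Suc d))"
  proof (intro flat.span_add flat.span_sum)
    show "u * ?x \<in> flat.span (monom_eval n ` ?M (Suc d))"
      by (rule step[OF Suc.IH[folded u_def]])
         (use F in \<open>auto simp: keys_add_nat weighted_add weighted_single split: if_splits\<close>)
  next
    fix H assume H: "H \<in> ?A"
    show "u * flat_gen n H \<in> flat.span (monom_eval n ` ?M (Suc d))"
      by (rule step[OF Suc.IH[folded u_def]])
         (use H card[OF H] in \<open>auto simp: keys_add_nat weighted_add weighted_single split: if_splits\<close>)
    show "?x ^ d * flat_gen n H \<in> flat.span (monom_eval n ` ?M (Suc d))"
      by (rule step[OF xd])
         (use F H card[OF H] in \<open>auto simp: keys_add_nat weighted_add weighted_single split: if_splits\<close>)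
  qed
  finally show ?case .
qed

text \<open>
  Monomials supported on a chain of nonempty finite sets with largest member \<open>F\<close> (\<open>F = {}\<close> for the
  monomial \<open>1\<close>), built from the bottom; \<open>ok d a\<close> says whether exponent \<open>a\<close> is admissible
  for a set with \<open>d\<close> elements more than its predecessor.  Both the basis of the Stanley-Reisner
  ring and the Feichtner-Yuzvinsky monomials are instances, so that they can be counted
  by the same recursion.
\<close>

inductive chain_monomial :: "(nat \<Rightarrow> nat \<Rightarrow> bool) \<Rightarrow> nat set \<Rightarrow> (nat set \<Rightarrow>\<^sub>0 nat) \<Rightarrow> bool" for ok where
  empty: "chain_monomial ok {} 0"
| extend: "chain_monomial ok G m \<Longrightarrow> G \<subset> F \<Longrightarrow> finite F \<Longrightarrow> 0 < a \<Longrightarrow> ok (card F - card G) a \<Longrightarrow>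
    chain_monomial ok F (m + Poly_Mapping.single F a)"

abbreviation (input) any_exponent :: "nat \<Rightarrow> nat \<Rightarrow> bool" where
  "any_exponent \<equiv> \<lambda>d a. True"

abbreviation (input) small_exponent :: "nat \<Rightarrow> nat \<Rightarrow> bool" where
  "small_exponent \<equiv> \<lambda>d a. a < d"

lemma chain_monomial_keys:
  "chain_monomial ok F m \<Longrightarrow> Poly_Mapping.keys m \<subseteq> Pow F - {{}} \<and> (F \<noteq> {} \<longrightarrow> F \<in> Poly_Mapping.keys m)"
  by (induction rule: chain_monomial.induct) (auto simp: keys_add_nat)

lemma chain_monomial_is_chain:
  "chain_monomial ok F m \<Longrightarrow> A \<in> Poly_Mapping.keys m \<Longrightarrow> B \<in> Poly_Mapping.keys m \<Longrightarrow> A \<subseteq> B \<or> B \<subseteq> A"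
proof (induction rule: chain_monomial.induct)
  case (extend G m F a)
  have "A \<subseteq> F" if "A \<in> Poly_Mapping.keys m" for A
    using chain_monomial_keys[OF extend.hyps(1)] extend.hyps(2) that by auto
  then show ?case using extend.IH extend.prems extend.hyps by (auto simp: keys_add_nat)
qed auto

lemma minus_single_add:
  fixes m :: "'a \<Rightarrow>\<^sub>0 nat"
  shows "a \<le> Poly_Mapping.lookup m F \<Longrightarrow> m - Poly_Mapping.single F a + Poly_Mapping.single F a = m"
  by (rule poly_mapping_eqI) (auto simp: lookup_add lookup_minus lookup_single when_def)

lemma chain_monomial_exists:
  assumes "\<And>A B. A \<in> Poly_Mapping.keys m \<Longrightarrow> B \<in> Poly_Mapping.keys m \<Longrightarrow> A \<subseteq> B \<or> B \<subseteq> A"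
    and "\<And>A. A \<in> Poly_Mapping.keys m \<Longrightarrow> finite A \<and> A \<noteq> {}"
  shows "\<exists>F. (F = {} \<or> F \<in> Poly_Mapping.keys m) \<and> chain_monomial any_exponent F m"
  using assms
proof (induction "card (Poly_Mapping.keys m)" arbitrary: m rule: less_induct)
  case less
  show ?case
  proof (cases "m = 0")
    case True
    then show ?thesis by (auto intro: chain_monomial.empty)
  next
    case False
    then obtain F where F: "F \<in> Poly_Mapping.keys m" and max: "\<And>A. A \<in> Poly_Mapping.keys m \<Longrightarrow> F \<subseteq> A \<Longrightarrow> A = F"
      using finite_has_maximal[of "Poly_Mapping.keys m"] by auto
    have top: "A \<subseteq> F" if "A \<in> Poly_Mapping.keys m" for A
      using less.prems(1)[OF that F] max[OF that] by auto
    define m' where "m' = m - Poly_Mapping.single F (Poly_Mapping.lookup m F)"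
    have m: "m = m' + Poly_Mapping.single F (Poly_Mapping.lookup m F)"
      by (simp add: m'_def minus_single_add)
    have keys': "Poly_Mapping.keys m' = Poly_Mapping.keys m - {F}"
      by (auto simp: m'_def in_keys_iff lookup_minus lookup_single when_def split: if_splits)
    have "card (Poly_Mapping.keys m') < card (Poly_Mapping.keys m)"
      unfolding keys' using F by (intro card_Diff1_less) auto
    then obtain G where G: "G = {} \<or> G \<in> Poly_Mapping.keys m'" "chain_monomial any_exponent G m'"
      using less.hyps[of m'] less.prems by (auto simp: keys')
    have "G \<subset> F" using G(1) top F less.prems(2)[OF F] by (auto simp: keys')
    then have "chain_monomial any_exponent F (m' + Poly_Mapping.single F (Poly_Mapping.lookup m F))"
      using G F less.prems(2)[OF F] by (intro chain_monomial.extend[of _ G]) (auto simp: in_keys_iff)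
    then show ?thesis using F m by auto
  qed
qed

text \<open>
  If some exponent is too large, the monomial is divisible by \<open>x\<^sub>G x\<^sub>H\<^sup>d\<close> for neighbours \<open>G \<subset> H\<close> of the chain
  and \<open>d = card H - card G\<close>, which is the shape to which the vanishing relation applies.
\<close>

lemma chain_monomial_small_or_reducible:
  assumes "chain_monomial any_exponent F m"
  shows "chain_monomial small_exponent F m \<or>
    (\<exists>G H r. G \<subset> H \<and> finite H \<and>
      m = r + (if G = {} then 0 else Poly_Mapping.single G 1) + Poly_Mapping.single H (card H - card G))"
  using assms
proof (induction rule: chain_monomial.induct)
  case empty
  then show ?case by (auto intro: chain_monomial.empty)
next
  case (extend G m F a)
  from extend.IH show ?case
  proof
    assume small: "chain_monomial small_exponent G m"
    show ?thesis
    proof (cases "a < card F - card G")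
      case True
      then show ?thesis using small extend.hyps by (auto intro: chain_monomial.extend)
    next
      case False
      let ?g = "if G = {} then 0 else Poly_Mapping.single G (1::nat)"
      let ?d = "card F - card G"
      have "m - ?g + ?g = m"
        using chain_monomial_keys[OF small] minus_single_add[of 1 m G] by (auto simp: in_keys_iff)
      moreover have "Poly_Mapping.single F (a - ?d) + Poly_Mapping.single F ?d = Poly_Mapping.single F a"
        using False by (simp flip: single_add)
      ultimately have "m + Poly_Mapping.single F a =
          (m - ?g + ?g) + (Poly_Mapping.single F (a - ?d) + Poly_Mapping.single F ?d)"
        by (simp only:)
      also have "\<dots> = (m - ?g + Poly_Mapping.single F (a - ?d)) + ?g + Poly_Mapping.single F ?d"
        by (simp only: ac_simps)
      finally have "m + Poly_Mapping.single F a =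
          (m - ?g + Poly_Mapping.single F (a - ?d)) + ?g + Poly_Mapping.single F ?d" .
      then show ?thesis using extend.hyps by blast
    qed
  next
    assume "\<exists>G H r. G \<subset> H \<and> finite H \<and>
      m = r + (if G = {} then 0 else Poly_Mapping.single G 1) + Poly_Mapping.single H (card H - card G)"
    then obtain G' H r where *: "G' \<subset> H" "finite H"
      "m = r + (if G' = {} then 0 else Poly_Mapping.single G' 1) + Poly_Mapping.single H (card H - card G')"
      by blast
    have "m + Poly_Mapping.single F a = (r + Poly_Mapping.single F a) +
        (if G' = {} then 0 else Poly_Mapping.single G' 1) + Poly_Mapping.single H (card H - card G')"
      unfolding *(3) by (simp add: algebra_simps)
    with * show ?thesis by blast
  qed
qed

definition chain_monomials :: "(nat \<Rightarrow> nat \<Rightarrow> bool) \<Rightarrow> nat set set \<Rightarrow> nat \<Rightarrow> (nat set \<Rightarrow>\<^sub>0 nat) set" where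
  "chain_monomials ok \<F> k = {m. \<exists>F\<in>\<F>. chain_monomial ok F m \<and> mdeg m = k}"

definition fy_monomials :: "nat \<Rightarrow> nat \<Rightarrow> (nat set \<Rightarrow>\<^sub>0 nat) set" where
  "fy_monomials n k = chain_monomials small_exponent (Pow {1..n}) k"

lemma monom_eval_incomparable:
  assumes "Poly_Mapping.keys m \<subseteq> flats n" "A \<in> Poly_Mapping.keys m" "B \<in> Poly_Mapping.keys m"
    "\<not> A \<subseteq> B" "\<not> B \<subseteq> A"
  shows "monom_eval n m \<in> chow_ideal n"
proof -
  define r where "r = m - Poly_Mapping.single A 1 - Poly_Mapping.single B 1"
  have m: "m = r + (Poly_Mapping.single A 1 + Poly_Mapping.single B 1)"
    by (rule poly_mapping_eqI)
       (use assms in \<open>auto simp: r_def lookup_add lookup_minus lookup_single when_def in_keys_iff\<close>)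
  have "Poly_Mapping.keys r \<subseteq> flats n"
    using assms(1) m by (auto simp: keys_add_nat)
  then have "monom_eval n r * (flat_gen n A * flat_gen n B) \<in> chow_ideal n"
    using assms by (intro chow_ideal_mult incomparable_flat_gen carrier_monom_eval) auto
  moreover have "monom_eval n m = monom_eval n r * (flat_gen n A * flat_gen n B)"
    unfolding m monom_eval_add by (simp add: monom_eval_single)
  ultimately show ?thesis by simp
qed

text \<open>
  A reducible monomial \<open>q x\<^sub>H\<^sup>d\<close>, where \<open>x\<^sub>G\<close> divides \<open>q\<close>, is congruent to
  \<open>- q ((\<Sum>\<^sub>K\<^sub>\<supseteq>\<^sub>H x\<^sub>K)\<^sup>d - x\<^sub>H\<^sup>d)\<close>, a combination of monomials of the same degree and larger cardinality weight.
  This terminates because that weight is at most \<open>n\<close> times the degree.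
\<close>

lemma monom_eval_straighten:
  assumes "Poly_Mapping.keys m \<subseteq> flats n"
  shows "monom_eval n m \<in> congruent_span n (monom_eval n ` fy_monomials n (mdeg m))"
  using assms
proof (induction "n * mdeg m - weighted card m" arbitrary: m rule: less_induct)
  case less
  let ?B = "monom_eval n ` fy_monomials n (mdeg m)"
  show ?case
  proof (cases "\<exists>A\<in>Poly_Mapping.keys m. \<exists>B\<in>Poly_Mapping.keys m. \<not> A \<subseteq> B \<and> \<not> B \<subseteq> A")
    case True
    then show ?thesis using monom_eval_incomparable[OF less.prems] congruent_span_ideal by blast
  next
    case False
    have "finite A \<and> A \<noteq> {}" if "A \<in> Poly_Mapping.keys m" for A
      using that less.prems finite_subset[of A "{1..n}"] by (auto simp: flats_def)
    with False obtain F where F: "F = {} \<or> F \<in> Poly_Mapping.keys m" "chain_monomial any_exponent F m"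
      using chain_monomial_exists[of m] by blast
    from chain_monomial_small_or_reducible[OF F(2)] show ?thesis
    proof
      assume "chain_monomial small_exponent F m"
      moreover have "F \<subseteq> {1..n}" using F less.prems by (auto simp: flats_def)
      ultimately show ?thesis by (intro congruent_span_base imageI) (auto simp: fy_monomials_def chain_monomials_def)
    next
      assume "\<exists>G H r. G \<subset> H \<and> finite H \<and>
        m = r + (if G = {} then 0 else Poly_Mapping.single G 1) + Poly_Mapping.single H (card H - card G)"
      then obtain G H r where GH: "G \<subset> H" "finite H" and
        m: "m = r + (if G = {} then 0 else Poly_Mapping.single G 1) + Poly_Mapping.single H (card H - card G)"
        by blast
      define d where "d = card H - card G"
      define q where "q = r + (if G = {} then 0 else Poly_Mapping.single G 1)"
      have mq: "m = q + Poly_Mapping.single H d" by (simp add: m q_def d_def)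
      have dG: "card (H - G) = d" using GH unfolding d_def
        by (intro card_Diff_subset) (auto intro: finite_subset)
      have "d > 0" using GH unfolding d_def by (simp add: psubset_card_mono)
      then have H: "H \<in> flats n" and q: "Poly_Mapping.keys q \<subseteq> flats n" and r: "Poly_Mapping.keys r \<subseteq> flats n"
        using less.prems by (auto simp: mq keys_add_nat q_def)
      have qG: "monom_eval n q = monom_eval n r * flat_gen0 n G"
        by (simp add: q_def monom_eval_add monom_eval_single monom_eval_0 flat_gen0_def)
      have "monom_eval n r * (flat_gen0 n G * upper_sum n H ^ d) \<in> chow_ideal n"
        by (rule chow_ideal_mult[OF upper_sum_power_vanishes carrier_monom_eval[OF r]])
           (use GH H dG in \<open>auto simp: flats_def\<close>)
      then have van: "monom_eval n q * upper_sum n H ^ d \<in> chow_ideal n"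
        by (simp add: qG mult.assoc)
      have "monom_eval n q * (upper_sum n H ^ d - flat_gen n H ^ d) \<in> congruent_span n ?B"
        using upper_sum_power_expand[OF H, of d]
      proof (induction rule: flat.span_induct_alt)
        case base
        then show ?case by (simp add: congruent_span_ideal chow_ideal_0)
      next
        case (step c b p)
        then obtain m' where m': "b = monom_eval n m'" "Poly_Mapping.keys m' \<subseteq> flats n" "mdeg m' = d"
          "d * card H < weighted card m'" by auto
        have deg: "mdeg (q + m') = mdeg m"
          by (simp add: mq m' weighted_add weighted_single)
        have keys: "Poly_Mapping.keys (q + m') \<subseteq> flats n"
          using q m' by (simp add: keys_add_nat)
        have "weighted card m < weighted card (q + m')"
          using m' by (simp add: mq weighted_add weighted_single)
        moreover have "weighted card (q + m') \<le> n * mdeg (q + m')"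
        proof (rule weighted_le)
          fix K assume "K \<in> Poly_Mapping.keys (q + m')"
          then have "K \<subseteq> {1..n}" using keys by (auto simp: flats_def)
          then show "card K \<le> n" using card_mono[of "{1..n}" K] by simp
        qed
        ultimately have "n * mdeg (q + m') - weighted card (q + m') < n * mdeg m - weighted card m"
          unfolding deg by linarith
        from less.hyps[OF this keys] have "monom_eval n q * b \<in> congruent_span n ?B"
          unfolding deg by (simp add: m' monom_eval_add)
        from congruent_span_add[OF congruent_span_scale[OF this, of c] step.IH] show ?case
          by (simp add: algebra_simps)
      qed
      then have "flat_const (- 1) * (monom_eval n q * (upper_sum n H ^ d - flat_gen n H ^ d)) \<in>
          congruent_span n ?B"
        by (rule congruent_span_scale)
      from congruent_span_add[OF congruent_span_ideal[OF van] this]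
      have "monom_eval n q * flat_gen n H ^ d \<in> congruent_span n ?B"
        unfolding flat_const_minus_1 right_diff_distrib minus_diff_eq by simp
      then show ?thesis by (simp add: mq monom_eval_add monom_eval_single)
    qed
  qed
qed

lemma fy_monomials_span:
  assumes "p \<in> carrier (flat_poly_ring n)" "homogeneous k p"
  shows "p \<in> congruent_span n (monom_eval n ` fy_monomials n k)"
proof -
  have "p \<in> flat.span ((\<lambda>m. Poly_Mapping.single m 1) ` Poly_Mapping.keys p)"
    by (rule in_span_monomials, rule flat.span_base, rule imageI)
  then show ?thesis
  proof (rule congruent_span_span, safe)
    fix m assume m: "m \<in> Poly_Mapping.keys p"
    then have keys: "Poly_Mapping.keys m \<subseteq> proper_flats n" and deg: "mdeg m = k"
      using assms by (auto simp: carrier_iff homogeneous_alt)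
    show "Poly_Mapping.single m 1 \<in>
        congruent_span n (monom_eval n ` fy_monomials n k)"
      using monom_eval_straighten[of m n] keys deg
      by (auto simp: monom_eval_proper[OF keys] proper_flats_alt)
  qed
qed

section \<open>The linear forms and the Stanley-Reisner ring\<close>

definition is_chain :: "(nat set \<Rightarrow>\<^sub>0 nat) \<Rightarrow> bool" where
  "is_chain m \<longleftrightarrow> (\<forall>A\<in>Poly_Mapping.keys m. \<forall>B\<in>Poly_Mapping.keys m. A \<subseteq> B \<or> B \<subseteq> A)"

definition nonchain_polys :: "nat \<Rightarrow> flat_poly set" where
  "nonchain_polys n = {q \<in> carrier (flat_poly_ring n). \<forall>m\<in>Poly_Mapping.keys q. \<not> is_chain m}"

text \<open>
  Since \<open>theta n 1 = 0\<close>, only \<open>theta n 2, \<dots>, theta n n\<close> contribute.  For positive \<open>n\<close> these are \<open>n - 1\<close> linear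
  forms, as many as the Krull dimension of the Stanley-Reisner ring.  All differences of two \<open>avoiding_sum\<close>s are
  combinations of them.
\<close>

definition theta :: "nat \<Rightarrow> nat \<Rightarrow> flat_poly" where
  "theta n i = avoiding_sum n i - avoiding_sum n 1"

lemma carrier_theta: "theta n i \<in> carrier (flat_poly_ring n)"
  unfolding theta_def by (intro carrier_diff carrier_avoiding_sum)

lemma homogeneous_theta: "homogeneous 1 (theta n i)"
  unfolding theta_def by (intro homogeneous_diff homogeneous_avoiding_sum)

lemma ideal_flat_poly_ringI:
  assumes "\<And>z. z \<in> N \<Longrightarrow> z \<in> carrier (flat_poly_ring n)" "0 \<in> N"
    and "\<And>z z'. z \<in> N \<Longrightarrow> z' \<in> N \<Longrightarrow> z + z' \<in> N"
    and mult: "\<And>p z. p \<in> carrier (flat_poly_ring n) \<Longrightarrow> z \<in> N \<Longrightarrow> p * z \<in> N"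
  shows "ideal N (flat_poly_ring n)"
proof (rule idealI)
  show "ring (flat_poly_ring n)" by (rule cring.axioms(1)[OF cring_flat_poly_ring])
  show "subgroup N (add_monoid (flat_poly_ring n))"
  proof (rule subgroup.intro)
    fix z assume z: "z \<in> N"
    have "- z \<in> N" using mult[of "- 1" z] z by (simp add: carrier_uminus carrier_1)
    then show "inv\<^bsub>add_monoid (flat_poly_ring n)\<^esub> z \<in> N"
      using flat_poly_ring_uminus[of z n] assms(1)[OF z] by (simp add: a_inv_def)
  qed (use assms in \<open>auto simp: flat_poly_ring_ops\<close>)
next
  fix a x assume "a \<in> N" "x \<in> carrier (flat_poly_ring n)"
  then have "x * a \<in> N" by (intro mult)
  then show "x \<otimes>\<^bsub>flat_poly_ring n\<^esub> a \<in> N" "a \<otimes>\<^bsub>flat_poly_ring n\<^esub> x \<in> N"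
    by (simp_all add: flat_poly_ring_ops mult.commute)
qed

lemma nonchain_polys_0: "0 \<in> nonchain_polys n"
  by (simp add: nonchain_polys_def carrier_0)

lemma nonchain_polys_add: "p \<in> nonchain_polys n \<Longrightarrow> q \<in> nonchain_polys n \<Longrightarrow> p + q \<in> nonchain_polys n"
  using keys_add[of p q] by (auto simp: nonchain_polys_def carrier_add)

lemma nonchain_polys_mult:
  assumes "p \<in> carrier (flat_poly_ring n)" "q \<in> nonchain_polys n"
  shows "p * q \<in> nonchain_polys n"
proof -
  have "\<not> is_chain m" if m: "m \<in> Poly_Mapping.keys (p * q)" for m
  proof -
    obtain a b where "m = a + b" "b \<in> Poly_Mapping.keys q"
      using keys_mult[of p q] m by blast
    moreover from this have "\<not> is_chain b" using assms by (auto simp: nonchain_polys_def)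
    ultimately show ?thesis by (auto simp: is_chain_def keys_add_nat)
  qed
  then show ?thesis using assms by (auto simp: nonchain_polys_def carrier_mult)
qed

lemma nonchain_polys_sum: "(\<And>i. i \<in> A \<Longrightarrow> f i \<in> nonchain_polys n) \<Longrightarrow> (\<Sum>i\<in>A. f i) \<in> nonchain_polys n"
  by (induction A rule: infinite_finite_induct) (auto simp: nonchain_polys_0 nonchain_polys_add)

text \<open>
  The elements of this shape form an ideal that contains all generators.  Having the
  polynomials \<open>q i\<close> explicit allows passing to homogeneous components.
\<close>

lemma chow_ideal_decompose:
  assumes "z \<in> chow_ideal n"
  shows "\<exists>q j. (\<forall>i. q i \<in> carrier (flat_poly_ring n)) \<and> j \<in> nonchain_polys n \<and>
    z = (\<Sum>i\<in>{1..n}. theta n i * q i) + j"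
proof -
  let ?N = "{z. \<exists>q j. (\<forall>i. q i \<in> carrier (flat_poly_ring n)) \<and> j \<in> nonchain_polys n \<and>
    z = (\<Sum>i\<in>{1..n}. theta n i * q i) + j}"
  have NI: "z \<in> ?N" if "\<And>i. q i \<in> carrier (flat_poly_ring n)" "j \<in> nonchain_polys n"
    "z = (\<Sum>i\<in>{1..n}. theta n i * q i) + j" for z q j
    using that by blast
  have "ideal ?N (flat_poly_ring n)"
  proof (rule ideal_flat_poly_ringI)
    fix z assume "z \<in> ?N"
    then show "z \<in> carrier (flat_poly_ring n)"
      by (auto simp: nonchain_polys_def intro!: carrier_add carrier_sum carrier_mult carrier_theta)
  next
    show "0 \<in> ?N" by (rule NI[of "\<lambda>_. 0" 0]) (auto simp: carrier_0 nonchain_polys_0)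
  next
    fix z z' assume "z \<in> ?N" "z' \<in> ?N"
    then obtain q j q' j' where *:
      "\<And>i. q i \<in> carrier (flat_poly_ring n)" "j \<in> nonchain_polys n"
      "z = (\<Sum>i\<in>{1..n}. theta n i * q i) + j"
      "\<And>i. q' i \<in> carrier (flat_poly_ring n)" "j' \<in> nonchain_polys n"
      "z' = (\<Sum>i\<in>{1..n}. theta n i * q' i) + j'" by blast
    show "z + z' \<in> ?N"
    proof (rule NI[of "\<lambda>i. q i + q' i" "j + j'"])
      show "q i + q' i \<in> carrier (flat_poly_ring n)" for i by (intro carrier_add *)
      show "j + j' \<in> nonchain_polys n" by (intro nonchain_polys_add *)
    qed (simp add: *(3,6) algebra_simps sum.distrib)
  next
    fix p z assume p: "p \<in> carrier (flat_poly_ring n)" and "z \<in> ?N"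
    then obtain q j where *:
      "\<And>i. q i \<in> carrier (flat_poly_ring n)" "j \<in> nonchain_polys n"
      "z = (\<Sum>i\<in>{1..n}. theta n i * q i) + j" by blast
    show "p * z \<in> ?N"
    proof (rule NI[of "\<lambda>i. p * q i" "p * j"])
      show "p * q i \<in> carrier (flat_poly_ring n)" for i by (intro carrier_mult p *)
      show "p * j \<in> nonchain_polys n" by (intro nonchain_polys_mult p *)
    qed (simp add: *(3) algebra_simps sum_distrib_left)
  qed
  then have "chow_ideal n \<subseteq> ?N"
  proof (rule chow_ideal_minimal)
    fix i j assume "i \<in> {1..n}" "j \<in> {1..n}"
    then have "avoiding_sum n i - avoiding_sum n j =
        (\<Sum>l\<in>{1..n}. if l = i then theta n l else 0) - (\<Sum>l\<in>{1..n}. if l = j then theta n l else 0)"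
      by (simp only: sum.delta finite_atLeastAtMost if_True) (simp add: theta_def)
    also have "\<dots> = (\<Sum>l\<in>{1..n}. theta n l * ((if l = i then 1 else 0) - (if l = j then 1 else 0)))"
      unfolding sum_subtractf[symmetric] by (intro sum.cong) auto
    finally show "avoiding_sum n i - avoiding_sum n j \<in> ?N"
      by (intro NI[of "\<lambda>l. (if l = i then 1 else 0) - (if l = j then 1 else 0)" 0])
         (auto simp: nonchain_polys_0 intro!: carrier_diff carrier_0 carrier_1 carrier_uminus)
  next
    fix F G assume FG: "F \<in> proper_flats n" "G \<in> proper_flats n" "\<not> F \<subseteq> G" "\<not> G \<subseteq> F"
    show "flat_var F * flat_var G \<in> ?N"
    proof (rule NI[of "\<lambda>_. 0"])
      have "\<not> is_chain (Poly_Mapping.single F 1 + Poly_Mapping.single G 1)"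
        using FG by (auto simp: is_chain_def keys_add_nat)
      then show "flat_var F * flat_var G \<in> nonchain_polys n"
        using FG by (auto simp: nonchain_polys_def flat_var_def mult_single carrier_iff keys_add_nat)
    qed (auto simp: carrier_0)
  qed
  with assms show ?thesis by blast
qed

lemma restrict_degree_mult:
  assumes t: "homogeneous 1 t"
  shows "restrict_mons (\<lambda>m. mdeg m = Suc k) (t * q) = t * restrict_mons (\<lambda>m. mdeg m = k) q"
    and "restrict_mons (\<lambda>m. mdeg m = 0) (t * q) = 0"
proof -
  have deg: "\<exists>b\<in>Poly_Mapping.keys p. mdeg m = Suc (mdeg b)" if "m \<in> Poly_Mapping.keys (t * p)" for m p
    using keys_mult[of t p] that t by (force simp: homogeneous_alt weighted_add)
  have q: "q = restrict_mons (\<lambda>m. mdeg m = k) q + restrict_mons (\<lambda>m. mdeg m \<noteq> k) q"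
    by (rule poly_mapping_eqI) (auto simp: lookup_add lookup_restrict_mons)
  have "restrict_mons (\<lambda>m. mdeg m = Suc k) (t * q) =
      restrict_mons (\<lambda>m. mdeg m = Suc k) (t * restrict_mons (\<lambda>m. mdeg m = k) q) +
      restrict_mons (\<lambda>m. mdeg m = Suc k) (t * restrict_mons (\<lambda>m. mdeg m \<noteq> k) q)"
    by (simp only: restrict_mons_add[symmetric] distrib_left[symmetric] q[symmetric])
  also have "restrict_mons (\<lambda>m. mdeg m = Suc k) (t * restrict_mons (\<lambda>m. mdeg m \<noteq> k) q) = 0"
    by (rule restrict_mons_eq_0) (auto dest!: deg simp: keys_restrict_mons)
  also have "restrict_mons (\<lambda>m. mdeg m = Suc k) (t * restrict_mons (\<lambda>m. mdeg m = k) q) =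
      t * restrict_mons (\<lambda>m. mdeg m = k) q"
    by (rule restrict_mons_id) (auto dest!: deg simp: keys_restrict_mons)
  finally show "restrict_mons (\<lambda>m. mdeg m = Suc k) (t * q) = t * restrict_mons (\<lambda>m. mdeg m = k) q"
    by simp
  show "restrict_mons (\<lambda>m. mdeg m = 0) (t * q) = 0"
    by (rule restrict_mons_eq_0) (auto dest!: deg)
qed

lemma homogeneous_restrict_degree: "homogeneous k (restrict_mons (\<lambda>m. mdeg m = k) q)"
  by (auto simp: homogeneous_alt keys_restrict_mons)

lemma nonchain_polys_restrict: "j \<in> nonchain_polys n \<Longrightarrow> restrict_mons P j \<in> nonchain_polys n"
  by (auto simp: nonchain_polys_def keys_restrict_mons carrier_restrict_mons)

text \<open>
  The degree \<open>k\<close> products of elements of the sets \<open>B\<close> with monomials in the first \<open>j\<close> linear forms.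
  Adjoining the forms one at a time makes the cardinalities obey the recursion of iterated
  partial sums, that is, of multiplication by \<open>1 / (1 - x)\<close>.
\<close>

fun theta_multiples :: "nat \<Rightarrow> (nat \<Rightarrow> flat_poly set) \<Rightarrow> nat \<Rightarrow> nat \<Rightarrow> flat_poly set" where
  "theta_multiples n B 0 k = B k"
| "theta_multiples n B (Suc j) 0 = theta_multiples n B j 0"
| "theta_multiples n B (Suc j) (Suc k) =
    theta_multiples n B j (Suc k) \<union> (\<lambda>p. theta n (j + 2) * p) ` theta_multiples n B (Suc j) k"

fun iterated_sum :: "(nat \<Rightarrow> nat) \<Rightarrow> nat \<Rightarrow> nat \<Rightarrow> nat" where
  "iterated_sum a 0 k = a k"
| "iterated_sum a (Suc j) k = (\<Sum>i\<le>k. iterated_sum a j i)"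

lemma theta_multiples_base: "B k \<subseteq> theta_multiples n B j k"
proof (induction j arbitrary: k)
  case (Suc j)
  then show ?case by (cases k) auto
qed auto

lemma theta_multiples_closed:
  "i < j \<Longrightarrow> p \<in> theta_multiples n B j k \<Longrightarrow> theta n (i + 2) * p \<in> theta_multiples n B j (Suc k)"
proof (induction n B j k arbitrary: p rule: theta_multiples.induct)
  case (2 n B j)
  then show ?case by (cases "i = j") auto
next
  case (3 n B j k)
  show ?case
  proof (cases "i = j")
    case True
    then show ?thesis using 3 by auto
  next
    case False
    with 3 have i: "i < j" by simp
    from 3(4) consider "p \<in> theta_multiples n B j (Suc k)"
      | p' where "p' \<in> theta_multiples n B (Suc j) k" "p = theta n (j + 2) * p'" by auto
    then show ?thesis
    proof cases
      case 1
      then show ?thesis using "3.IH"(1)[OF i] by simp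
    next
      case (2 p')
      have "theta n (i + 2) * p' \<in> theta_multiples n B (Suc j) (Suc k)"
        using "3.IH"(2)[OF _ 2(1)] i by simp
      then have "theta n (j + 2) * (theta n (i + 2) * p') \<in> theta_multiples n B (Suc j) (Suc (Suc k))"
        unfolding theta_multiples.simps(3)[of n B j "Suc k"] by (intro UnI2 imageI)
      then show ?thesis by (simp add: 2 mult_ac)
    qed
  qed
qed auto

lemma finite_theta_multiples: "(\<And>k. finite (B k)) \<Longrightarrow> finite (theta_multiples n B j k)"
  by (induction n B j k rule: theta_multiples.induct) auto

lemma card_theta_multiples:
  "(\<And>k. finite (B k)) \<Longrightarrow> card (theta_multiples n B j k) \<le> iterated_sum (\<lambda>k. card (B k)) j k"
proof (induction n B j k rule: theta_multiples.induct)
  case (3 n B j k)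
  have "card (theta_multiples n B (Suc j) (Suc k)) \<le> card (theta_multiples n B j (Suc k)) +
      card ((\<lambda>p. theta n (j + 2) * p) ` theta_multiples n B (Suc j) k)"
    unfolding theta_multiples.simps by (rule card_Un_le)
  also have "card ((\<lambda>p. theta n (j + 2) * p) ` theta_multiples n B (Suc j) k) \<le>
      card (theta_multiples n B (Suc j) k)"
    by (rule card_image_le) (rule finite_theta_multiples[OF 3(3)])
  also have "card (theta_multiples n B j (Suc k)) + card (theta_multiples n B (Suc j) k) \<le>
      iterated_sum (\<lambda>k. card (B k)) j (Suc k) + iterated_sum (\<lambda>k. card (B k)) (Suc j) k"
    by (intro add_mono 3)
  finally show ?case by simp
qed auto

text \<open>
  The graded Nakayama lemma: modulo the linear forms the sets \<open>B\<close> suffice by hypothesis, and the cofactors of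
  the linear forms have smaller degree, so that the induction hypothesis applies to them.
\<close>

lemma theta_multiples_span:
  assumes B: "\<And>k p. p \<in> B k \<Longrightarrow> p \<in> carrier (flat_poly_ring n) \<and> homogeneous k p"
    and span: "\<And>k p. p \<in> carrier (flat_poly_ring n) \<Longrightarrow> homogeneous k p \<Longrightarrow> p \<in> congruent_span n (B k)"
    and p: "p \<in> carrier (flat_poly_ring n)" "homogeneous k p"
  shows "\<exists>j\<in>nonchain_polys n. p - j \<in> flat.span (theta_multiples n B (n - 1) k)"
  using p
proof (induction k arbitrary: p)
  case (0 p)
  obtain s where s: "s \<in> flat.span (B 0)" "p - s \<in> chow_ideal n"
    using span[OF 0] by (auto simp: congruent_span_def)
  have hom: "homogeneous 0 (p - s)"
    using homogeneous_span[OF s(1)] B 0 by (intro homogeneous_diff) auto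
  obtain q j where qj: "j \<in> nonchain_polys n" "p - s = (\<Sum>i\<in>{1..n}. theta n i * q i) + j"
    using chow_ideal_decompose[OF s(2)] by blast
  have "p - s = restrict_mons (\<lambda>m. mdeg m = 0) (p - s)"
    by (rule restrict_mons_id[symmetric]) (use hom in \<open>auto simp: homogeneous_alt\<close>)
  also have "\<dots> = restrict_mons (\<lambda>m. mdeg m = 0) j"
    by (simp only: qj restrict_mons_add restrict_mons_sum restrict_degree_mult(2)[OF homogeneous_theta]) simp
  finally have "p - restrict_mons (\<lambda>m. mdeg m = 0) j = s" by (simp add: algebra_simps)
  moreover have "s \<in> flat.span (theta_multiples n B (n - 1) 0)"
    by (rule subsetD[OF flat.span_mono[OF theta_multiples_base[of B]] s(1)])
  ultimately show ?case 
    by (intro bexI[of _ "restrict_mons (\<lambda>m. mdeg m = 0) j"] nonchain_polys_restrict[OF qj(1)]) simp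
next
  case (Suc k p)
  let ?T = "theta_multiples n B (n - 1)"
  obtain s where s: "s \<in> flat.span (B (Suc k))" "p - s \<in> chow_ideal n"
    using span[OF Suc.prems] by (auto simp: congruent_span_def)
  have hom: "homogeneous (Suc k) (p - s)"
    using homogeneous_span[OF s(1)] B Suc.prems by (intro homogeneous_diff) auto
  obtain q j where qj: "\<And>i. q i \<in> carrier (flat_poly_ring n)" "j \<in> nonchain_polys n"
    "p - s = (\<Sum>i\<in>{1..n}. theta n i * q i) + j"
    using chow_ideal_decompose[OF s(2)] by blast
  define q' where "q' i = restrict_mons (\<lambda>m. mdeg m = k) (q i)" for i
  define j' where "j' = restrict_mons (\<lambda>m. mdeg m = Suc k) j"
  have j': "j' \<in> nonchain_polys n" unfolding j'_def by (rule nonchain_polys_restrict[OF qj(2)])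
  have "p - s = restrict_mons (\<lambda>m. mdeg m = Suc k) (p - s)"
    by (rule restrict_mons_id[symmetric]) (use hom in \<open>auto simp: homogeneous_alt\<close>)
  also have "\<dots> = (\<Sum>i\<in>{1..n}. theta n i * q' i) + j'"
    by (simp only: qj restrict_mons_add restrict_mons_sum restrict_degree_mult(1)[OF homogeneous_theta]
        q'_def j'_def)
  finally have ps: "p - s = (\<Sum>i\<in>{1..n}. theta n i * q' i) + j'" .
  have "\<forall>i. \<exists>r\<in>nonchain_polys n. q' i - r \<in> flat.span (?T k)"
    unfolding q'_def by (intro allI Suc.IH carrier_restrict_mons qj homogeneous_restrict_degree)
  then obtain r where r: "\<And>i. r i \<in> nonchain_polys n" "\<And>i. q' i - r i \<in> flat.span (?T k)"
    by metis
  have "theta n i * (q' i - r i) \<in> flat.span (?T (Suc k))" if i: "i \<in> {1..n}" for i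
  proof (cases "i = 1")
    case True
    then show ?thesis by (simp add: theta_def flat.span_zero)
  next
    case False
    then have i': "i = (i - 2) + 2" "i - 2 < n - 1" using i by auto
    \<comment> \<open>The forms are numbered from 0 in the recursion, so that number i - 2 belongs to the element i.\<close>
    have cl: "theta n i * b \<in> ?T (Suc k)" if "b \<in> ?T k" for b
      using theta_multiples_closed[OF i'(2) that] i'(1) by simp
    show ?thesis using r(2)[of i]
    proof (induction rule: flat.span_induct_alt)
      case base
      then show ?case by (simp add: flat.span_zero)
    next
      case (step c b x)
      from flat.span_add[OF flat.span_scale[OF flat.span_base[OF cl[OF step.hyps]], of c] step.IH]
      show ?case by (simp add: algebra_simps)
    qed
  qed
  then have "s + (\<Sum>i\<in>{1..n}. theta n i * (q' i - r i)) \<in> flat.span (?T (Suc k))"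
    by (intro flat.span_add flat.span_sum subsetD[OF flat.span_mono[OF theta_multiples_base[of B]] s(1)])
  moreover have "s + (\<Sum>i\<in>{1..n}. theta n i * (q' i - r i)) =
      p - ((\<Sum>i\<in>{1..n}. theta n i * r i) + j')"
  proof -
    have "(\<Sum>i\<in>{1..n}. theta n i * (q' i - r i)) =
        (\<Sum>i\<in>{1..n}. theta n i * q' i) - (\<Sum>i\<in>{1..n}. theta n i * r i)"
      by (simp only: right_diff_distrib sum_subtractf)
    then show ?thesis using ps by (simp add: algebra_simps)
  qed
  moreover have "(\<Sum>i\<in>{1..n}. theta n i * r i) + j' \<in> nonchain_polys n"
    by (intro nonchain_polys_add nonchain_polys_sum nonchain_polys_mult carrier_theta r j')
  ultimately show ?case by (intro bexI) simp_all
qed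

definition proper_chain_monomials :: "nat \<Rightarrow> nat \<Rightarrow> (nat set \<Rightarrow>\<^sub>0 nat) set" where
  "proper_chain_monomials n k = {m. Poly_Mapping.keys m \<subseteq> proper_flats n \<and> is_chain m \<and> mdeg m = k}"

text \<open>
  Deleting the monomials whose support is not a chain is the projection to the
  Stanley-Reisner ring; there the chain monomials are linearly independent and lie in the
  span of the images of the \<open>theta_multiples\<close>.
\<close>

lemma card_proper_chain_monomials_le:
  assumes B: "\<And>k p. p \<in> B k \<Longrightarrow> p \<in> carrier (flat_poly_ring n) \<and> homogeneous k p"
    and span: "\<And>k p. p \<in> carrier (flat_poly_ring n) \<Longrightarrow> homogeneous k p \<Longrightarrow> p \<in> congruent_span n (B k)"
    and fin: "\<And>k. finite (B k)"
  shows "card (proper_chain_monomials n k) \<le> iterated_sum (\<lambda>k. card (B k)) (n - 1) k"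
proof -
  let ?e = "\<lambda>m. Poly_Mapping.single m 1 :: flat_poly"
  let ?T = "theta_multiples n B (n - 1) k"
  have sub: "?e ` proper_chain_monomials n k \<subseteq> flat.span (restrict_mons is_chain ` ?T)"
  proof safe
    fix m assume m: "m \<in> proper_chain_monomials n k"
    then obtain j where j: "j \<in> nonchain_polys n" "?e m - j \<in> flat.span ?T"
      using theta_multiples_span[where B = B and p = "?e m" and k = k, OF B span]
      by (auto simp: proper_chain_monomials_def carrier_iff homogeneous_alt)
    have "restrict_mons is_chain (?e m - j) = ?e m"
    proof -
      have "restrict_mons is_chain (?e m) = ?e m"
        by (rule restrict_mons_id) (use m in \<open>auto simp: proper_chain_monomials_def\<close>)
      moreover have "restrict_mons is_chain j = 0"
        by (rule restrict_mons_eq_0) (use j in \<open>auto simp: nonchain_polys_def\<close>)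
      ultimately show ?thesis by (simp add: restrict_mons_diff)
    qed
    then show "?e m \<in> flat.span (restrict_mons is_chain ` ?T)"
      using restrict_mons_span[OF j(2), of is_chain] by simp
  qed
  have "card (proper_chain_monomials n k) = card (?e ` proper_chain_monomials n k)"
    by (rule card_image[symmetric]) (rule inj_onI, drule arg_cong[of _ _ Poly_Mapping.keys], simp)
  also have "\<dots> = flat.dim (?e ` proper_chain_monomials n k)"
    by (rule flat.dim_eq_card_independent[OF independent_monomials, symmetric])
  also have "\<dots> \<le> card (restrict_mons is_chain ` ?T)"
    by (rule flat.dim_le_card[OF sub]) (intro finite_imageI finite_theta_multiples fin)
  also have "\<dots> \<le> card ?T" by (intro card_image_le finite_theta_multiples fin)
  also have "\<dots> \<le> iterated_sum (\<lambda>k. card (B k)) (n - 1) k"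
    by (rule card_theta_multiples[OF fin])
  finally show ?thesis .
qed

section \<open>Weighted chains and their exponential generating functions\<close>

unbundle fps_syntax

text \<open>
  The generating function of the chains \<open>\<emptyset> = F\<^sub>0 \<subset> \<dots> \<subset> F\<^sub>r\<close> with \<open>F\<^sub>r\<close> a fixed set of \<open>n\<close> elements, where a step
  of size \<open>d\<close> contributes the factor \<open>w d\<close>; the recursion removes one step.
\<close>

fun weighted_compositions :: "(nat \<Rightarrow> 'a::comm_ring_1) \<Rightarrow> nat \<Rightarrow> 'a" where
  "weighted_compositions w n =
     (if n = 0 then 1 else \<Sum>d\<in>{1..n}. of_nat (n choose d) * w d * weighted_compositions w (n - d))"

declare weighted_compositions.simps [simp del]

text \<open>
  The same for chains whose largest member is an arbitrary subset.
\<close>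

definition weighted_chains :: "(nat \<Rightarrow> 'a::comm_ring_1) \<Rightarrow> nat \<Rightarrow> 'a" where
  "weighted_chains w n = (\<Sum>j\<le>n. of_nat (n choose j) * weighted_compositions w j)"

lemma weighted_compositions_0: "weighted_compositions w 0 = 1"
  by (simp add: weighted_compositions.simps)

lemma weighted_chains_0: "weighted_chains w 0 = 1"
  by (simp add: weighted_chains_def weighted_compositions_0)

text \<open>
  Compatibility with ring homomorphisms is needed for two of them: the evaluation of integer polynomials at
  integers, seen as real numbers, and the embedding of polynomials into power series.
\<close>

locale ring_hom_fun =
  fixes f :: "'a::comm_ring_1 \<Rightarrow> 'b::comm_ring_1"
  assumes hom_0: "f 0 = 0" and hom_1: "f 1 = 1"
    and hom_add: "f (a + b) = f a + f b" and hom_mult: "f (a * b) = f a * f b"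
begin

lemma hom_sum: "f (\<Sum>i\<in>A. g i) = (\<Sum>i\<in>A. f (g i))"
  by (induction A rule: infinite_finite_induct) (auto simp: hom_0 hom_add)

lemma hom_of_nat: "f (of_nat n) = of_nat n"
  by (induction n) (auto simp: hom_0 hom_1 hom_add)

lemma hom_power: "f (a ^ n) = f a ^ n"
  by (induction n) (auto simp: hom_1 hom_mult)

lemma hom_weighted_compositions: "f (weighted_compositions w n) = weighted_compositions (\<lambda>d. f (w d)) n"
proof (induction n rule: less_induct)
  case (less n)
  show ?case
    by (subst (1 2) weighted_compositions.simps)
       (auto simp: hom_1 hom_sum hom_mult hom_of_nat less.IH intro!: sum.cong)
qed

lemma hom_weighted_chains: "f (weighted_chains w n) = weighted_chains (\<lambda>d. f (w d)) n"
  by (simp add: weighted_chains_def hom_sum hom_mult hom_of_nat hom_weighted_compositions)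

end

text \<open>
  The weight of a step of size \<open>d\<close> lists the exponents \<open>1, \<dots>, d - 1\<close> admissible in a
  Feichtner-Yuzvinsky monomial.
\<close>

definition eulerian :: "nat \<Rightarrow> int poly" where
  "eulerian n = weighted_chains (\<lambda>d. \<Sum>a\<in>{1..<d}. [:0, 1:] ^ a) n"

definition eulerian_val :: "real \<Rightarrow> nat \<Rightarrow> real" where
  "eulerian_val x n = weighted_chains (\<lambda>d. \<Sum>a\<in>{1..<d}. x ^ a) n"

lemma eval_ring_hom: "ring_hom_fun (\<lambda>p. real_of_int (poly p x))"
  by unfold_locales auto

lemma poly_eulerian: "real_of_int (poly (eulerian n) x) = eulerian_val (real_of_int x) n"
proof -
  interpret ring_hom_fun "\<lambda>p. real_of_int (poly p x)" by (rule eval_ring_hom)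
  show ?thesis
    unfolding eulerian_def eulerian_val_def hom_weighted_chains hom_sum hom_power by simp
qed

definition egf :: "(nat \<Rightarrow> real) \<Rightarrow> real fps" where
  "egf a = Abs_fps (\<lambda>n. a n / fact n)"

lemma egf_mult: "egf a * egf b = egf (\<lambda>n. \<Sum>i\<le>n. of_nat (n choose i) * a i * b (n - i))"
proof (rule fps_ext)
  fix n
  have "(egf a * egf b) $ n = (\<Sum>i\<le>n. a i / fact i * (b (n - i) / fact (n - i)))"
    by (simp add: fps_mult_nth egf_def atLeast0AtMost)
  also have "\<dots> = (\<Sum>i\<le>n. of_nat (n choose i) * a i * b (n - i) / fact n)"
    by (intro sum.cong refl) (simp add: binomial_fact field_simps)
  finally show "(egf a * egf b) $ n = egf (\<lambda>n. \<Sum>i\<le>n. of_nat (n choose i) * a i * b (n - i)) $ n"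
    by (simp add: egf_def sum_divide_distrib)
qed

text \<open>
  Write \<open>H\<close> and \<open>W\<close> for the exponential generating functions of the weighted compositions and of the weights
  \<open>w\<^sub>d = x + \<dots> + x\<^sup>d\<^sup>-\<^sup>1\<close>.  The recursion says \<open>H = 1 + W H\<close>, the geometric sum says
  \<open>(x - 1) W = e\<^sup>x\<^sup>t - x e\<^sup>t + (x - 1)\<close>, and passing to chains with arbitrary top multiplies \<open>H\<close> by \<open>e\<^sup>t\<close>.
\<close>

lemma egf_eulerian:
  assumes x: "x \<noteq> 1"
  shows "egf (eulerian_val x) * (fps_const x - fps_exp (x - 1)) = fps_const (x - 1)"
proof -
  define w where "w d = (\<Sum>a\<in>{1..<d}. x ^ a)" for d
  define H where "H = egf (weighted_compositions w)"
  have w: "(x - 1) * w d = (if d = 0 then 0 else x ^ d - x)" for d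
  proof (induction d)
    case (Suc d)
    then show ?case by (cases "d = 0") (auto simp: w_def algebra_simps)
  qed (simp add: w_def)
  have W: "fps_const (x - 1) * egf w = fps_exp x - fps_const x * fps_exp 1 + fps_const (x - 1)"
  proof (rule fps_ext)
    fix n
    show "(fps_const (x - 1) * egf w) $ n =
        (fps_exp x - fps_const x * fps_exp 1 + fps_const (x - 1)) $ n"
      using w[of n] by (auto simp: egf_def diff_divide_distrib split: if_splits)
  qed
  have H: "H = 1 + egf w * H"
  proof (rule fps_ext)
    fix n
    show "H $ n = (1 + egf w * H) $ n"
    proof (cases "n = 0")
      case True
      then show ?thesis by (simp add: H_def egf_mult) (simp add: egf_def w_def weighted_compositions_0)
    next
      case False
      have "{..n} = insert 0 {1..n}" by auto
      then have "(\<Sum>i\<le>n. of_nat (n choose i) * w i * weighted_compositions w (n - i)) =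
          weighted_compositions w n"
        using False by (subst (2) weighted_compositions.simps) (simp add: w_def)
      then show ?thesis using False by (simp add: H_def egf_mult) (simp add: egf_def)
    qed
  qed
  have B: "egf (eulerian_val x) = fps_exp 1 * H"
  proof -
    have "fps_exp 1 = egf (\<lambda>_. 1)" by (rule fps_ext) (simp add: egf_def)
    then have "fps_exp 1 * H = H * egf (\<lambda>_. 1)" by simp
    also have "\<dots> = egf (eulerian_val x)"
      unfolding H_def egf_mult by (simp add: eulerian_val_def[abs_def] weighted_chains_def w_def[abs_def])
    finally show ?thesis by simp
  qed
  have "fps_const (x - 1) * H = fps_const (x - 1) + fps_const (x - 1) * egf w * H"
    by (subst H) (simp add: algebra_simps)
  then have *: "H * (fps_const x * fps_exp 1 - fps_exp x) = fps_const (x - 1)"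
    unfolding W by (simp add: algebra_simps)
  have "fps_exp x = fps_exp 1 * fps_exp (x - 1)"
    by (simp flip: fps_exp_add_mult)
  then show ?thesis using * unfolding B by (simp add: algebra_simps)
qed

text \<open>
  The form in which the closed formula is matched with the count of all chain monomials.  It is the coefficient
  of \<open>t\<^sup>n\<close> in \<open>x A(t) e\<^sup>(\<^sup>1\<^sup>-\<^sup>x\<^sup>)\<^sup>t - A(t) = (x - 1) e\<^sup>(\<^sup>1\<^sup>-\<^sup>x\<^sup>)\<^sup>t\<close>, divided by \<open>1 - x\<close>.
\<close>

lemma eulerian_val_recurrence:
  assumes x: "x \<noteq> 1" and n: "n > 0"
  shows "eulerian_val x n = (1 - x) ^ (n - 1) +
    x * (\<Sum>j\<in>{1..<n}. of_nat (n choose j) * eulerian_val x j * (1 - x) ^ (n - 1 - j))"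
proof -
  let ?B = "egf (eulerian_val x)"
  have e: "fps_exp (1 - x) = egf (\<lambda>n. (1 - x) ^ n)"
    by (rule fps_ext) (simp add: egf_def)
  have "fps_exp (x - 1) * fps_exp (1 - x) = 1"
    by (simp flip: fps_exp_add_mult)
  then have "fps_const x * (?B * fps_exp (1 - x)) - ?B =
      ?B * (fps_const x - fps_exp (x - 1)) * fps_exp (1 - x)"
    by (simp add: algebra_simps)
  also have "\<dots> = fps_const (x - 1) * fps_exp (1 - x)"
    by (simp add: egf_eulerian[OF x])
  finally have "(fps_const x * (?B * fps_exp (1 - x)) - ?B) $ n = (fps_const (x - 1) * fps_exp (1 - x)) $ n"
    by simp
  then have S: "x * (\<Sum>i\<le>n. of_nat (n choose i) * eulerian_val x i * (1 - x) ^ (n - i)) - eulerian_val x n =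
      (x - 1) * (1 - x) ^ n"
    unfolding e egf_mult by (simp add: egf_def field_simps)
  let ?T = "\<Sum>i\<in>{1..<n}. of_nat (n choose i) * eulerian_val x i * (1 - x) ^ (n - 1 - i)"
  have "{..n} = insert 0 (insert n {1..<n})" using n by auto
  then have "(\<Sum>i\<le>n. of_nat (n choose i) * eulerian_val x i * (1 - x) ^ (n - i)) =
      (1 - x) ^ n + eulerian_val x n + (\<Sum>i\<in>{1..<n}. of_nat (n choose i) * eulerian_val x i * (1 - x) ^ (n - i))"
    using n by (simp add: eulerian_val_def weighted_chains_0)
  also have "(\<Sum>i\<in>{1..<n}. of_nat (n choose i) * eulerian_val x i * (1 - x) ^ (n - i)) = (1 - x) * ?T"
    unfolding sum_distrib_left
  proof (intro sum.cong refl)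
    fix i assume "i \<in> {1..<n}"
    then have "n - i = Suc (n - 1 - i)" by auto
    then show "of_nat (n choose i) * eulerian_val x i * (1 - x) ^ (n - i) =
        (1 - x) * (of_nat (n choose i) * eulerian_val x i * (1 - x) ^ (n - 1 - i))" by simp
  qed
  finally have "x * ((1 - x) ^ n + eulerian_val x n + (1 - x) * ?T) - eulerian_val x n = (x - 1) * (1 - x) ^ n"
    using S by simp
  then have "(1 - x) * eulerian_val x n = (1 - x) ^ n + (1 - x) * (x * ?T)"
    by (simp add: algebra_simps)
  also have "(1 - x) ^ n = (1 - x) * (1 - x) ^ (n - 1)"
    using n by (cases n) auto
  finally have "(1 - x) * eulerian_val x n = (1 - x) * ((1 - x) ^ (n - 1) + x * ?T)"
    by (simp only: distrib_left)
  then show ?thesis using x by simp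
qed

text \<open>
  The substitution of \<open>u + v\<close> for the variable, where series in \<open>u\<close> and \<open>v\<close> are series in \<open>u\<close> whose
  coefficients are series in \<open>v\<close>.  Composition of power series does not provide it, as \<open>u + v\<close> has
  the nonzero constant coefficient \<open>v\<close> as a series in \<open>u\<close>.
\<close>

definition fps_shift_var :: "real fps \<Rightarrow> real fps fps" where
  "fps_shift_var f = Abs_fps (\<lambda>n. Abs_fps (\<lambda>m. of_nat ((n + m) choose n) * f $ (n + m)))"

text \<open>
  The substitution of \<open>u\<close> for the variable; that of \<open>v\<close> is \<open>fps_const\<close>.
\<close>

definition fps_outer :: "real fps \<Rightarrow> real fps fps" where
  "fps_outer f = Abs_fps (\<lambda>n. fps_const (f $ n))"

lemma fps_outer_mult: "fps_outer (f * g) = fps_outer f * fps_outer g"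
  by (intro fps_ext) (simp add: fps_outer_def fps_mult_nth fps_sum_nth)

text \<open>
  Comparing coefficients, this is Vandermonde's convolution.
\<close>

lemma fps_shift_var_mult: "fps_shift_var (f * g) = fps_shift_var f * fps_shift_var g"
proof (intro fps_ext)
  fix n m :: nat
  let ?N = "n + m"
  let ?t = "\<lambda>k i. real (k choose i) * real ((?N - k) choose (n - i)) * (f $ k * g $ (?N - k))"
  have "(fps_shift_var f * fps_shift_var g) $ n $ m =
      (\<Sum>i\<le>n. \<Sum>j\<le>m. real ((i + j) choose i) * f $ (i + j) *
        (real ((n - i + (m - j)) choose (n - i)) * g $ (n - i + (m - j))))"
    by (simp add: fps_shift_var_def fps_mult_nth fps_sum_nth atLeast0AtMost add_ac)
  also have "\<dots> = (\<Sum>i\<le>n. \<Sum>k\<le>?N. ?t k i)"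
  proof (rule sum.cong[OF refl])
    fix i assume i: "i \<in> {..n}"
    have "(\<Sum>j\<le>m. real ((i + j) choose i) * f $ (i + j) *
        (real ((n - i + (m - j)) choose (n - i)) * g $ (n - i + (m - j)))) = (\<Sum>j\<le>m. ?t (i + j) i)"
    proof (intro sum.cong refl)
      fix j assume "j \<in> {..m}"
      then have "n - i + (m - j) = ?N - (i + j)" using i by auto
      then show "real ((i + j) choose i) * f $ (i + j) *
        (real ((n - i + (m - j)) choose (n - i)) * g $ (n - i + (m - j))) = ?t (i + j) i" by simp
    qed
    also have "\<dots> = (\<Sum>k\<in>(+) i ` {..m}. ?t k i)"
      by (subst sum.reindex) auto
    also have "\<dots> = (\<Sum>k\<le>?N. ?t k i)"
    proof (rule sum.mono_neutral_left)
      show "\<forall>k\<in>{..?N} - (+) i ` {..m}. ?t k i = 0"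
      proof
        fix k assume k: "k \<in> {..?N} - (+) i ` {..m}"
        show "?t k i = 0"
        proof (cases "k < i")
          case False
          then have "k - i > m" using k by (auto simp: image_iff) (metis add_diff_inverse_nat atMost_iff not_le_imp_less)
          then have "?N - k < n - i" using i k by auto
          then show ?thesis by simp
        qed simp
      qed
    qed (use i in auto)
    finally show "(\<Sum>j\<le>m. real ((i + j) choose i) * f $ (i + j) *
        (real ((n - i + (m - j)) choose (n - i)) * g $ (n - i + (m - j)))) = (\<Sum>k\<le>?N. ?t k i)" .
  qed
  also have "\<dots> = (\<Sum>k\<le>?N. \<Sum>i\<le>n. ?t k i)" by (rule sum.swap)
  also have "\<dots> = (\<Sum>k\<le>?N. real (?N choose n) * (f $ k * g $ (?N - k)))"
  proof (rule sum.cong[OF refl])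
    fix k assume "k \<in> {..?N}"
    then have "?N choose n = (\<Sum>i\<le>n. (k choose i) * ((?N - k) choose (n - i)))"
      using vandermonde[of k "?N - k" n] by simp
    then show "(\<Sum>i\<le>n. ?t k i) = real (?N choose n) * (f $ k * g $ (?N - k))"
      by (simp add: sum_distrib_right)
  qed
  also have "\<dots> = fps_shift_var (f * g) $ n $ m"
    by (simp add: fps_shift_var_def fps_mult_nth atLeast0AtMost sum_distrib_left)
  finally show "fps_shift_var (f * g) $ n $ m = (fps_shift_var f * fps_shift_var g) $ n $ m" by simp
qed

text \<open>
  Let \<open>J = (x - e\<^sup>c\<^sup>t) / c\<close> with \<open>c = x - 1\<close> be the inverse of \<open>A\<close>.  Then
  \<open>J(u) J(v) = J(u + v) + x (1 - J(u)) (1 - J(v))\<close>, since for positive \<open>n\<close> and \<open>m\<close> all three coefficients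
  of \<open>u\<^sup>n v\<^sup>m\<close> are multiples of \<open>c\<^sup>n\<^sup>+\<^sup>m / (n! m!)\<close>, with factors \<open>1 / c\<^sup>2\<close>, \<open>- 1 / c\<close> and \<open>x / c\<^sup>2\<close>.
  Multiplying by \<open>A(u) A(v) A(u + v)\<close> and taking coefficients gives the claim.
\<close>

lemma eulerian_val_addition:
  assumes x: "x \<noteq> 1"
  shows "eulerian_val x (n + m) = eulerian_val x n * eulerian_val x m +
    x * (\<Sum>r\<in>{0<..n}. \<Sum>s\<in>{0<..m}. of_nat (n choose r) * of_nat (m choose s) *
      eulerian_val x r * eulerian_val x s * eulerian_val x (n + m - r - s))"
proof -
  define c where "c = x - 1"
  have c: "c \<noteq> 0" using x by (simp add: c_def)
  define B where "B = egf (eulerian_val x)"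
  define J where "J = fps_const (1 / c) * (fps_const x - fps_exp c)"
  have "B * J = fps_const (1 / c) * (B * (fps_const x - fps_exp c))"
    by (simp add: J_def mult_ac)
  also have "\<dots> = 1"
    using egf_eulerian[OF x] c by (simp add: B_def c_def)
  finally have BI: "B * J = 1" .
  have I0: "J $ 0 = 1" using x by (simp add: J_def c_def)
  have IS: "J $ k = - (c ^ k / c / fact k)" if "k > 0" for k
    using that by (simp add: J_def)
  define U V D where "U = fps_outer B" and "V = fps_const B" and "D = fps_shift_var B"
  define Ui Vi Di where "Ui = fps_outer J" and "Vi = fps_const J" and "Di = fps_shift_var J"
  define xc where "xc = fps_const (fps_const x)"
  have one: "fps_outer 1 = 1" "fps_shift_var 1 = 1"
    by (intro fps_ext; simp add: fps_outer_def fps_shift_var_def)+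
  have inv: "U * Ui = 1" "V * Vi = 1" "D * Di = 1"
    unfolding U_def Ui_def V_def Vi_def D_def Di_def
    by (simp_all add: BI one flip: fps_outer_mult fps_shift_var_mult)
  have key: "Ui * Vi = Di + xc * (1 - Ui) * (1 - Vi)"
  proof (intro fps_ext)
    fix n m :: nat
    have "(Ui * Vi) $ n $ m = J $ n * J $ m"
      by (simp add: Ui_def Vi_def fps_outer_def)
    moreover have "(xc * (1 - Ui) * (1 - Vi)) $ n $ m =
        x * ((if n = 0 then 1 else 0) - J $ n) * ((if m = 0 then 1 else 0) - J $ m)"
    proof -
      have "1 - Vi = fps_const (1 - J)" by (simp add: Vi_def fps_const_sub flip: fps_const_1_eq_1)
      then have "(xc * (1 - Ui) * (1 - Vi)) $ n $ m = (fps_const x * (1 - Ui) $ n * (1 - J)) $ m"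
        by (simp add: xc_def)
      also have "(1 - Ui) $ n = fps_const ((if n = 0 then 1 else 0) - J $ n)"
        by (auto simp: Ui_def fps_outer_def)
      finally show ?thesis by (auto simp: algebra_simps)
    qed
    moreover have "Di $ n $ m = of_nat ((n + m) choose n) * J $ (n + m)"
      by (simp add: Di_def fps_shift_var_def)
    moreover have "J $ n * J $ m = of_nat ((n + m) choose n) * J $ (n + m) +
        x * ((if n = 0 then 1 else 0) - J $ n) * ((if m = 0 then 1 else 0) - J $ m)"
    proof (cases "n = 0 \<or> m = 0")
      case True
      then show ?thesis by (auto simp: I0)
    next
      case False
      have "real ((n + m) choose n) / fact (n + m) = 1 / (fact n * fact m)"
        by (simp add: binomial_fact)
      then have "of_nat ((n + m) choose n) * J $ (n + m) = - (c ^ (n + m) / c / (fact n * fact m))"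
        using False by (simp add: IS field_simps)
      moreover have "J $ n * J $ m = c ^ (n + m) / (c * c) / (fact n * fact m)"
        using False by (simp add: IS power_add)
      ultimately have "of_nat ((n + m) choose n) * J $ (n + m) = - c * (J $ n * J $ m)"
        using c by simp
      moreover have "x = c + 1" by (simp add: c_def)
      ultimately show ?thesis
        using False by (simp add: algebra_simps)
    qed
    ultimately show "(Ui * Vi) $ n $ m = (Di + xc * (1 - Ui) * (1 - Vi)) $ n $ m" by simp
  qed
  have "D = U * V + xc * (U - 1) * (V - 1) * D"
  proof -
    have "D = (U * Ui) * (V * Vi) * D" by (simp add: inv)
    also have "\<dots> = (Ui * Vi) * (U * V * D)" by (simp add: mult_ac)
    also have "\<dots> = (D * Di) * (U * V) + xc * (U - U * Ui) * (V - V * Vi) * D"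
      unfolding key by (simp add: algebra_simps)
    finally show ?thesis by (simp add: inv)
  qed
  then have "D $ n $ m = (U * V) $ n $ m + (xc * (U - 1) * (V - 1) * D) $ n $ m"
    by (metis fps_add_nth)
  moreover have D_nth: "D $ i $ j = eulerian_val x (i + j) / (fact i * fact j)" for i j
    by (simp add: D_def fps_shift_var_def B_def egf_def binomial_fact)
  moreover have "(U * V) $ n $ m = eulerian_val x n * eulerian_val x m / (fact n * fact m)"
    by (simp add: U_def V_def fps_outer_def B_def egf_def)
  moreover have "(xc * (U - 1) * (V - 1) * D) $ n $ m = x * (\<Sum>r\<in>{0<..n}. \<Sum>s\<in>{0<..m}.
      of_nat (n choose r) * of_nat (m choose s) *
      eulerian_val x r * eulerian_val x s * eulerian_val x (n + m - r - s)) / (fact n * fact m)"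
  proof -
    have B0: "B $ 0 = 1" by (simp add: B_def egf_def eulerian_val_def weighted_chains_0)
    have V1: "V - 1 = fps_const (B - 1)" by (simp add: V_def fps_const_sub flip: fps_const_1_eq_1)
    have "(xc * (U - 1) * (V - 1) * D) $ n $ m = x * ((U - 1) * (fps_const (B - 1) * D)) $ n $ m"
      by (simp add: xc_def V1 mult.assoc)
    also have "((U - 1) * (fps_const (B - 1) * D)) $ n $ m =
        (\<Sum>r\<in>{0..n}. ((U - 1) $ r * ((B - 1) * D $ (n - r))) $ m)"
      by (simp add: fps_mult_nth[of "U - 1"] fps_sum_nth)
    also have "\<dots> = (\<Sum>r\<in>{0<..n}. ((U - 1) $ r * ((B - 1) * D $ (n - r))) $ m)"
      by (intro sum.mono_neutral_right) (auto simp: U_def fps_outer_def B0)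
    also have "\<dots> = (\<Sum>r\<in>{0<..n}. \<Sum>s\<in>{0<..m}. B $ r * (B $ s * D $ (n - r) $ (m - s)))"
    proof (rule sum.cong[OF refl])
      fix r assume r: "r \<in> {0<..n}"
      have "((U - 1) $ r * ((B - 1) * D $ (n - r))) $ m = B $ r * ((B - 1) * D $ (n - r)) $ m"
        using r by (simp add: U_def fps_outer_def)
      also have "((B - 1) * D $ (n - r)) $ m = (\<Sum>s\<in>{0..m}. (B - 1) $ s * D $ (n - r) $ (m - s))"
        by (simp add: fps_mult_nth)
      also have "\<dots> = (\<Sum>s\<in>{0<..m}. (B - 1) $ s * D $ (n - r) $ (m - s))"
        by (intro sum.mono_neutral_right) (auto simp: B0)
      also have "\<dots> = (\<Sum>s\<in>{0<..m}. B $ s * D $ (n - r) $ (m - s))"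
        by (intro sum.cong) auto
      finally show "((U - 1) $ r * ((B - 1) * D $ (n - r))) $ m =
          (\<Sum>s\<in>{0<..m}. B $ r * (B $ s * D $ (n - r) $ (m - s)))"
        by (simp add: sum_distrib_left)
    qed
    also have "x * \<dots> = x * (\<Sum>r\<in>{0<..n}. \<Sum>s\<in>{0<..m}.
        of_nat (n choose r) * of_nat (m choose s) *
        eulerian_val x r * eulerian_val x s * eulerian_val x (n + m - r - s) / (fact n * fact m))"
    proof (intro arg_cong[of _ _ "(*) x"] sum.cong refl)
      fix r s assume rs: "r \<in> {0<..n}" "s \<in> {0<..m}"
      then have "n - r + (m - s) = n + m - r - s" by auto
      then have D: "D $ (n - r) $ (m - s) = eulerian_val x (n + m - r - s) / (fact (n - r) * fact (m - s))"
        by (simp only: D_nth)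
      show "B $ r * (B $ s * D $ (n - r) $ (m - s)) = of_nat (n choose r) * of_nat (m choose s) *
        eulerian_val x r * eulerian_val x s * eulerian_val x (n + m - r - s) / (fact n * fact m)"
        using rs unfolding D by (simp add: B_def egf_def binomial_fact field_simps)
    qed
    finally show ?thesis by (simp only: sum_divide_distrib[symmetric] times_divide_eq_right)
  qed
  ultimately show ?thesis by (simp add: field_simps)
qed

text \<open>
  Integer evaluation points suffice, and \<open>1\<close>, at which the generating functions degenerate, may be left out:
  a nonzero polynomial has only finitely many roots.
\<close>

lemma int_poly_eqI:
  fixes p q :: "int poly"
  assumes "\<And>x. x \<noteq> 1 \<Longrightarrow> poly p x = poly q x"
  shows "p = q"
proof (rule ccontr)
  assume "p \<noteq> q"
  then have "finite {x. poly (p - q) x = 0}" by (intro poly_roots_finite) auto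
  moreover have "- {1} \<subseteq> {x. poly (p - q) x = 0}" using assms by auto
  ultimately have "finite (- {1::int})" by (rule rev_finite_subset)
  then have "finite (UNIV :: int set)" using finite_insert[of 1 "- {1::int}"] by (simp add: insert_absorb Compl_insert)
  then show False by simp
qed

lemma eulerian_recurrence:
  assumes "n > 0"
  shows "eulerian n = (1 - [:0, 1:]) ^ (n - 1) +
    [:0, 1:] * (\<Sum>j\<in>{1..<n}. of_nat (n choose j) * eulerian j * (1 - [:0, 1:]) ^ (n - 1 - j))"
proof (rule int_poly_eqI)
  fix x :: int assume x: "x \<noteq> 1"
  interpret ring_hom_fun "\<lambda>p. real_of_int (poly p x)" by (rule eval_ring_hom)
  have "real_of_int (poly (eulerian n) x) = real_of_int (poly ((1 - [:0, 1:]) ^ (n - 1) +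
    [:0, 1:] * (\<Sum>j\<in>{1..<n}. of_nat (n choose j) * eulerian j * (1 - [:0, 1:]) ^ (n - 1 - j))) x)"
    unfolding hom_add hom_mult hom_sum hom_power hom_of_nat poly_eulerian
    using eulerian_val_recurrence[of "real_of_int x" n] x assms by simp
  then show "poly (eulerian n) x = poly ((1 - [:0, 1:]) ^ (n - 1) +
    [:0, 1:] * (\<Sum>j\<in>{1..<n}. of_nat (n choose j) * eulerian j * (1 - [:0, 1:]) ^ (n - 1 - j))) x"
    by (simp only: of_int_eq_iff)
qed

lemma eulerian_addition:
  "eulerian (n + m) = eulerian n * eulerian m +
     [:0, 1:] * (\<Sum>r\<in>{0<..n}. \<Sum>s\<in>{0<..m}.
       of_nat (n choose r) * of_nat (m choose s) * eulerian r * eulerian s * eulerian (n + m - r - s))"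
  (is "_ = ?R")
proof (rule int_poly_eqI)
  fix x :: int assume x: "x \<noteq> 1"
  interpret ring_hom_fun "\<lambda>p. real_of_int (poly p x)" by (rule eval_ring_hom)
  have "real_of_int (poly (eulerian (n + m)) x) = real_of_int (poly ?R x)"
    unfolding hom_add hom_mult hom_sum hom_of_nat poly_eulerian
    using eulerian_val_addition[of "real_of_int x" n m] x by simp
  then show "poly (eulerian (n + m)) x = poly ?R x" by (simp only: of_int_eq_iff)
qed

section \<open>Counting chain monomials\<close>

lemma sum_Pow_card:
  fixes f :: "nat \<Rightarrow> 'a::comm_ring_1"
  assumes "finite F"
  shows "(\<Sum>G\<in>Pow F. f (card G)) = (\<Sum>j\<le>card F. of_nat (card F choose j) * f j)"
proof -
  have "(\<Sum>G\<in>Pow F. f (card G)) = (\<Sum>j\<in>{..card F}. \<Sum>G | G \<in> Pow F \<and> card G = j. f (card G))"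
    by (rule sum.group[symmetric]) (use assms in \<open>auto intro: card_mono\<close>)
  also have "\<dots> = (\<Sum>j\<le>card F. of_nat (card F choose j) * f j)"
  proof (rule sum.cong[OF refl])
    fix j
    have "(\<Sum>G | G \<in> Pow F \<and> card G = j. f (card G)) = (\<Sum>G | G \<in> Pow F \<and> card G = j. f j)"
      by (intro sum.cong) auto
    also have "\<dots> = of_nat (card F choose j) * f j"
      using n_subsets[OF assms, of j] by simp
    finally show "(\<Sum>G | G \<in> Pow F \<and> card G = j. f (card G)) = of_nat (card F choose j) * f j" .
  qed
  finally show ?thesis .
qed

lemma sum_psubset_card:
  fixes f :: "nat \<Rightarrow> 'a::comm_ring_1"
  assumes "finite F"
  shows "(\<Sum>G | G \<subset> F. f (card G)) = (\<Sum>j<card F. of_nat (card F choose j) * f j)"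
proof -
  have fin: "finite {G. G \<subset> F}" by (rule finite_subset[of _ "Pow F"]) (use assms in auto)
  have "Pow F = insert F {G. G \<subset> F}" by auto
  then have "(\<Sum>G\<in>Pow F. f (card G)) = (\<Sum>G\<in>insert F {G. G \<subset> F}. f (card G))" by (rule arg_cong)
  also have "\<dots> = f (card F) + (\<Sum>G | G \<subset> F. f (card G))"
    using fin by (rule sum.insert) simp
  finally have "(\<Sum>G\<in>Pow F. f (card G)) = f (card F) + (\<Sum>G | G \<subset> F. f (card G))" .
  moreover have "(\<Sum>j\<le>card F. of_nat (card F choose j) * f j) =
      (\<Sum>j<card F. of_nat (card F choose j) * f j) + f (card F)"
    by (simp flip: lessThan_Suc_atMost)
  ultimately show ?thesis using sum_Pow_card[OF assms, of f] by simp
qed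

lemma chain_monomial_top_unique:
  assumes "chain_monomial ok F m" "chain_monomial ok' G m"
  shows "F = G"
  using chain_monomial_keys[OF assms(1)] chain_monomial_keys[OF assms(2)] by blast

lemma chain_monomial_empty_iff: "chain_monomial ok {} m \<longleftrightarrow> m = 0"
  by (subst chain_monomial.simps) auto

lemma chain_monomial_cases:
  assumes "F \<noteq> {}" "finite F"
  shows "chain_monomial ok F m \<longleftrightarrow> (\<exists>G m' a. G \<subset> F \<and> 0 < a \<and> ok (card F - card G) a \<and>
    chain_monomial ok G m' \<and> m = m' + Poly_Mapping.single F a)"
  using assms by (subst chain_monomial.simps) blast

text \<open>
  A chain monomial with top \<open>F\<close> arises from exactly one chain monomial with a smaller top by multiplication
  with a power of \<open>x\<^sub>F\<close>; top, exponent and cofactor can all be read off.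
\<close>

lemma chain_monomials_insert_top:
  fixes ok :: "nat \<Rightarrow> nat \<Rightarrow> bool" and F :: "nat set"
  assumes F: "F \<noteq> {}" "finite F"
  defines "S \<equiv> \<lambda>k. SIGMA (G, a) : {(G, a). G \<subset> F \<and> a \<in> {0<..k} \<and> ok (card F - card G) a}. chain_monomials ok {G} (k - a)"
  shows "bij_betw (\<lambda>((G, a), m). m + Poly_Mapping.single F a) (S k) (chain_monomials ok {F} k)"
proof (rule bij_betw_imageI)
  let ?f = "\<lambda>((G, a), m). m + Poly_Mapping.single F a"
  show "inj_on ?f (S k)"
  proof (rule inj_onI)
    fix x y assume S: "x \<in> S k" "y \<in> S k" and f: "?f x = ?f y"
    obtain G a m where x: "x = ((G, a), m)" by (metis surj_pair)
    obtain G' a' m' where y: "y = ((G', a'), m')" by (metis surj_pair)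
    have *: "G \<subset> F" "chain_monomial ok G m" "G' \<subset> F" "chain_monomial ok G' m'"
      using S x y by (simp_all add: S_def chain_monomials_def)
    have F0: "Poly_Mapping.lookup m F = 0" "Poly_Mapping.lookup m' F = 0"
      using chain_monomial_keys[OF *(2)] chain_monomial_keys[OF *(4)] *(1,3)
      by (auto simp flip: not_in_keys_iff_lookup_eq_zero)
    have eq: "m + Poly_Mapping.single F a = m' + Poly_Mapping.single F a'"
      using f by (simp add: x y)
    have "a = a'" using arg_cong[OF eq, of "\<lambda>m. Poly_Mapping.lookup m F"] F0 by (simp add: lookup_add)
    moreover from this have "m = m'" using eq by simp
    moreover from this have "G = G'" using chain_monomial_top_unique *(2,4) by blast
    ultimately show "x = y" by (simp add: x y)
  qed
  show "?f ` S k = chain_monomials ok {F} k"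
  proof (intro equalityI subsetI)
    fix m' assume "m' \<in> ?f ` S k"
    then obtain x where x: "x \<in> S k" "m' = ?f x" by (rule imageE)
    obtain G a m where "x = ((G, a), m)" by (metis surj_pair)
    with x show "m' \<in> chain_monomials ok {F} k"
      using F chain_monomial.extend[of ok G m F a]
      by (simp add: S_def chain_monomials_def weighted_add weighted_single)
  next
    fix m assume "m \<in> chain_monomials ok {F} k"
    then have m: "chain_monomial ok F m" "mdeg m = k" by (auto simp: chain_monomials_def)
    then obtain G m' a where *: "G \<subset> F" "0 < a" "ok (card F - card G) a" "chain_monomial ok G m'"
      "m = m' + Poly_Mapping.single F a"
      unfolding chain_monomial_cases[OF F] by blast
    have "((G, a), m') \<in> S k"
      using * m(2) by (simp add: S_def chain_monomials_def weighted_add weighted_single)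
    moreover have "m = ?f ((G, a), m')" using *(5) by simp
    ultimately show "m \<in> ?f ` S k" by (rule rev_image_eqI)
  qed
qed

definition exponent_weight :: "(nat \<Rightarrow> nat \<Rightarrow> bool) \<Rightarrow> nat \<Rightarrow> int fps" where
  "exponent_weight ok d = Abs_fps (\<lambda>a. if 0 < a \<and> ok d a then 1 else 0)"

lemma weighted_compositions_alt:
  assumes "n > 0"
  shows "weighted_compositions w n = (\<Sum>j<n. of_nat (n choose j) * (w (n - j) * weighted_compositions w j))"
proof -
  have "weighted_compositions w n = (\<Sum>d\<in>{1..n}. of_nat (n choose d) * w d * weighted_compositions w (n - d))"
    using assms by (subst weighted_compositions.simps) simp
  also have "\<dots> = (\<Sum>j<n. of_nat (n choose j) * (w (n - j) * weighted_compositions w j))"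
    by (rule sum.reindex_bij_witness[of _ "\<lambda>j. n - j" "\<lambda>d. n - d"])
       (auto simp: binomial_symmetric[symmetric] mult.assoc)
  finally show ?thesis .
qed

lemma card_chain_monomials_top:
  assumes "finite F"
  shows "finite (chain_monomials ok {F} k) \<and>
    int (card (chain_monomials ok {F} k)) = weighted_compositions (exponent_weight ok) (card F) $ k"
  using assms
proof (induction "card F" arbitrary: F k rule: less_induct)
  case less
  let ?w = "exponent_weight ok"
  show ?case
  proof (cases "F = {}")
    case True
    have "chain_monomials ok {{}} k = (if k = 0 then {0} else {})"
      by (auto simp: chain_monomials_def chain_monomial_empty_iff weighted_0)
    then show ?thesis by (simp add: True weighted_compositions_0)
  next
    case False
    let ?I = "{(G, a). G \<subset> F \<and> a \<in> {0<..k} \<and> ok (card F - card G) a}"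
    have finP: "finite {G. G \<subset> F}" by (rule finite_subset[of _ "Pow F"]) (use less.prems in auto)
    have finI: "finite ?I" by (rule finite_subset[of _ "{G. G \<subset> F} \<times> {0<..k}"]) (use finP in auto)
    have IH: "finite (chain_monomials ok {G} l)"
      "int (card (chain_monomials ok {G} l)) = weighted_compositions ?w (card G) $ l" if "G \<subset> F" for G l
      using less.hyps[of G l] psubset_card_mono[OF less.prems that]
        finite_subset[OF psubset_imp_subset[OF that] less.prems] by simp_all
    note bij = chain_monomials_insert_top[OF False less.prems, where ok = ok and k = k]
    let ?S = "SIGMA (G, a) : ?I. chain_monomials ok {G} (k - a)"
    have fin: "finite ?S" using IH(1) finI by (intro finite_SigmaI) auto
    have "int (card (chain_monomials ok {F} k)) = int (card ?S)"
      using bij_betw_same_card[OF bij] by simp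
    also have "\<dots> = (\<Sum>(G, a)\<in>?I. int (card (chain_monomials ok {G} (k - a))))"
      using finI IH(1) by (subst card_SigmaI) (auto simp: case_prod_unfold)
    also have "\<dots> = (\<Sum>(G, a)\<in>{G. G \<subset> F} \<times> {0..k}. ?w (card F - card G) $ a *
        weighted_compositions ?w (card G) $ (k - a))"
    proof (rule sum.mono_neutral_cong_left)
      show "finite ({G. G \<subset> F} \<times> {0..k})" using finP by simp
      show "?I \<subseteq> {G. G \<subset> F} \<times> {0..k}" by (rule subsetI) (simp add: split_paired_all)
      show "\<forall>i\<in>{G. G \<subset> F} \<times> {0..k} - ?I. (case i of (G, a) \<Rightarrow>
          ?w (card F - card G) $ a * weighted_compositions ?w (card G) $ (k - a)) = 0"
        by (rule ballI) (force simp add: split_paired_all exponent_weight_def)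
      show "(case p of (G, a) \<Rightarrow> int (card (chain_monomials ok {G} (k - a)))) = (case p of (G, a) \<Rightarrow>
          ?w (card F - card G) $ a * weighted_compositions ?w (card G) $ (k - a))" if "p \<in> ?I" for p
        using that by (cases p) (simp add: IH(2) exponent_weight_def)
    qed
    also have "\<dots> = (\<Sum>G | G \<subset> F. ?w (card F - card G) * weighted_compositions ?w (card G)) $ k"
      by (simp add: sum.cartesian_product[symmetric] fps_sum_nth fps_mult_nth)
    also have "(\<Sum>G | G \<subset> F. ?w (card F - card G) * weighted_compositions ?w (card G)) =
        (\<Sum>j<card F. of_nat (card F choose j) * (?w (card F - j) * weighted_compositions ?w j))"
      by (rule sum_psubset_card[OF less.prems])
    also have "\<dots> = weighted_compositions ?w (card F)"
      using False less.prems by (intro weighted_compositions_alt[symmetric]) (simp add: card_gt_0_iff)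
    finally have "int (card (chain_monomials ok {F} k)) = weighted_compositions ?w (card F) $ k" .
    moreover have "finite (chain_monomials ok {F} k)"
      using bij_betw_finite[OF bij] fin by simp
    ultimately show ?thesis by simp
  qed
qed

lemma card_chain_monomials:
  assumes "finite \<F>" "\<And>F. F \<in> \<F> \<Longrightarrow> finite F"
  shows "finite (chain_monomials ok \<F> k)"
    and "int (card (chain_monomials ok \<F> k)) =
      (\<Sum>F\<in>\<F>. weighted_compositions (exponent_weight ok) (card F)) $ k"
proof -
  have eq: "chain_monomials ok \<F> k = (\<Union>F\<in>\<F>. chain_monomials ok {F} k)"
    by (auto simp: chain_monomials_def)
  show "finite (chain_monomials ok \<F> k)"
    unfolding eq using assms card_chain_monomials_top by auto
  have "card (\<Union>F\<in>\<F>. chain_monomials ok {F} k) = (\<Sum>F\<in>\<F>. card (chain_monomials ok {F} k))"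
    using assms card_chain_monomials_top
    by (intro card_UN_disjoint) (auto simp: chain_monomials_def dest: chain_monomial_top_unique)
  then show "int (card (chain_monomials ok \<F> k)) =
      (\<Sum>F\<in>\<F>. weighted_compositions (exponent_weight ok) (card F)) $ k"
    unfolding eq using assms card_chain_monomials_top by (simp add: fps_sum_nth)
qed

lemma fps_of_poly_ring_hom: "ring_hom_fun (fps_of_poly :: int poly \<Rightarrow> int fps)"
  by unfold_locales (auto simp: fps_of_poly_add fps_of_poly_mult)

lemma card_fy_monomials:
  "int (card (fy_monomials n k)) = coeff (eulerian n) k"
proof -
  interpret ring_hom_fun "fps_of_poly :: int poly \<Rightarrow> int fps" by (rule fps_of_poly_ring_hom)
  have w: "exponent_weight small_exponent = (\<lambda>d. fps_of_poly (\<Sum>a\<in>{1..<d}. [:0, 1:] ^ a))"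
  proof (intro ext fps_ext)
    fix d a
    have "fps_of_poly [:0, 1 :: int:] = fps_X" by (rule fps_of_poly_fps_X)
    then show "exponent_weight small_exponent d $ a = fps_of_poly (\<Sum>a\<in>{1..<d}. [:0, 1:] ^ a) $ a"
      by (simp add: exponent_weight_def hom_sum hom_power fps_sum_nth fps_X_power_nth del: fps_of_poly_nth)
  qed
  have "int (card (fy_monomials n k)) =
      (\<Sum>F\<in>Pow {1..n}. weighted_compositions (exponent_weight small_exponent) (card F)) $ k"
    unfolding fy_monomials_def by (rule card_chain_monomials) (auto intro: finite_subset[of _ "{Suc 0..n}"])
  also have "(\<Sum>F\<in>Pow {1..n}. weighted_compositions (exponent_weight small_exponent) (card F)) =
      weighted_chains (exponent_weight small_exponent) n"
    using sum_Pow_card[of "{1..n}" "weighted_compositions (exponent_weight small_exponent)"]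
    by (simp add: weighted_chains_def)
  also have "\<dots> = fps_of_poly (eulerian n)"
    unfolding eulerian_def hom_weighted_chains w ..
  finally show ?thesis by simp
qed

lemma proper_chain_monomials_eq:
  assumes "n > 0"
  shows "proper_chain_monomials n k = chain_monomials any_exponent {F. F \<subset> {1..n}} k"
proof (intro equalityI subsetI)
  fix m assume m: "m \<in> proper_chain_monomials n k"
  then have keys: "A \<noteq> {} \<and> A \<subset> {1..n}" if "A \<in> Poly_Mapping.keys m" for A
    using that by (auto simp: proper_chain_monomials_def proper_flats_def)
  have "finite A \<and> A \<noteq> {}" if "A \<in> Poly_Mapping.keys m" for A
    using keys[OF that] finite_subset[of A "{1..n}", OF _ finite_atLeastAtMost] by blast
  then obtain F where F: "F = {} \<or> F \<in> Poly_Mapping.keys m" "chain_monomial any_exponent F m"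
    using chain_monomial_exists[of m] m by (auto simp: proper_chain_monomials_def is_chain_def)
  then have "F \<subset> {1..n}" using keys[of F] assms by auto
  then show "m \<in> chain_monomials any_exponent {F. F \<subset> {1..n}} k"
    using F m by (auto simp: chain_monomials_def proper_chain_monomials_def)
next
  fix m assume "m \<in> chain_monomials any_exponent {F. F \<subset> {1..n}} k"
  then obtain F where F: "F \<subset> {1..n}" "chain_monomial any_exponent F m" "mdeg m = k"
    by (auto simp: chain_monomials_def)
  have "Poly_Mapping.keys m \<subseteq> proper_flats n"
    using chain_monomial_keys[OF F(2)] F(1) by (auto simp: proper_flats_def)
  then show "m \<in> proper_chain_monomials n k"
    using F chain_monomial_is_chain[OF F(2)] by (auto simp: proper_chain_monomials_def is_chain_def)
qed

text \<open>
  The Hilbert series of the Stanley-Reisner ring: the sum runs over the possible sizes of a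
  top that is a proper subset.
\<close>

definition proper_chain_series :: "nat \<Rightarrow> int fps" where
  "proper_chain_series n =
     (\<Sum>j<n. of_nat (n choose j) * weighted_compositions (exponent_weight any_exponent) j)"

lemma card_proper_chain_monomials:
  assumes "n > 0"
  shows "int (card (proper_chain_monomials n k)) = proper_chain_series n $ k"
proof -
  have "finite {F. F \<subset> {1..n}}" by (rule finite_subset[of _ "Pow {1..n}"]) auto
  then have "int (card (proper_chain_monomials n k)) =
      (\<Sum>F | F \<subset> {1..n}. weighted_compositions (exponent_weight any_exponent) (card F)) $ k"
    unfolding proper_chain_monomials_eq[OF assms]
    by (rule card_chain_monomials) (auto intro: finite_subset[of _ "{Suc 0..n}"])
  also have "(\<Sum>F | F \<subset> {1..n}. weighted_compositions (exponent_weight any_exponent) (card F)) =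
      proper_chain_series n"
    using sum_psubset_card[of "{1..n}" "weighted_compositions (exponent_weight any_exponent)"]
    by (simp add: proper_chain_series_def)
  finally show ?thesis .
qed

lemma exponent_weight_any: "exponent_weight any_exponent d * (1 - fps_X) = fps_X"
proof (rule fps_ext)
  fix k
  show "(exponent_weight any_exponent d * (1 - fps_X)) $ k = fps_X $ k"
    by (cases k) (auto simp: exponent_weight_def right_diff_distrib)
qed

text \<open>
  Without restriction on the exponents every step has weight \<open>x / (1 - x)\<close>, so removing the last step of a
  chain with fixed top leaves a chain of proper subsets and this factor.
\<close>

lemma weighted_compositions_any:
  assumes "n > 0"
  shows "weighted_compositions (exponent_weight any_exponent) n * (1 - fps_X) = fps_X * proper_chain_series n"
proof -
  let ?w = "exponent_weight any_exponent"
  have "weighted_compositions ?w n * (1 - fps_X) =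
      (\<Sum>j<n. of_nat (n choose j) * ((?w (n - j) * (1 - fps_X)) * weighted_compositions ?w j))"
    unfolding weighted_compositions_alt[OF assms] sum_distrib_right by (simp only: mult_ac)
  also have "\<dots> = fps_X * proper_chain_series n"
    unfolding exponent_weight_any proper_chain_series_def sum_distrib_left by (simp only: mult_ac)
  finally show ?thesis .
qed

text \<open>
  Substituting the previous lemma into the definition of the series expresses it by the series for
  smaller ground sets.  After multiplication by \<open>(1 - x)\<^sup>n\<^sup>-\<^sup>1\<close> this is the recursion of the Eulerian
  polynomials.
\<close>

lemma proper_chain_series_eulerian:
  "n > 0 \<Longrightarrow> proper_chain_series n * (1 - fps_X) ^ (n - 1) = fps_of_poly (eulerian n)"
proof (induction n rule: less_induct)
  case (less n)
  interpret ring_hom_fun "fps_of_poly :: int poly \<Rightarrow> int fps" by (rule fps_of_poly_ring_hom)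
  let ?p = "1 - fps_X :: int fps"
  let ?c = "weighted_compositions (exponent_weight any_exponent)"
  have "{..<n} = insert 0 {1..<n}" using less.prems by auto
  then have "proper_chain_series n = (\<Sum>j\<in>insert 0 {1..<n}. of_nat (n choose j) * ?c j)"
    unfolding proper_chain_series_def by (rule arg_cong)
  also have "\<dots> = 1 + (\<Sum>j\<in>{1..<n}. of_nat (n choose j) * ?c j)"
    by (simp add: weighted_compositions_0)
  finally have "proper_chain_series n * ?p ^ (n - 1) =
      ?p ^ (n - 1) + (\<Sum>j\<in>{1..<n}. of_nat (n choose j) * ?c j * ?p ^ (n - 1))"
    by (simp only: distrib_right mult_1_left sum_distrib_right)
  also have "(\<Sum>j\<in>{1..<n}. of_nat (n choose j) * ?c j * ?p ^ (n - 1)) =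
      (\<Sum>j\<in>{1..<n}. fps_X * (of_nat (n choose j) * fps_of_poly (eulerian j) * ?p ^ (n - 1 - j)))"
  proof (rule sum.cong[OF refl])
    fix j assume j: "j \<in> {1..<n}"
    then have "n - 1 = Suc ((j - 1) + (n - 1 - j))" by auto
    then have "?p ^ (n - 1) = ?p ^ Suc ((j - 1) + (n - 1 - j))" by (rule arg_cong)
    also have "\<dots> = ?p * (?p ^ (j - 1) * ?p ^ (n - 1 - j))" by (simp only: power_Suc power_add)
    finally have "?c j * ?p ^ (n - 1) = (?c j * ?p) * (?p ^ (j - 1) * ?p ^ (n - 1 - j))"
      by (simp only: mult.assoc)
    also have "?c j * ?p = fps_X * proper_chain_series j"
      using j by (intro weighted_compositions_any) auto
    also have "fps_X * proper_chain_series j * (?p ^ (j - 1) * ?p ^ (n - 1 - j)) =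
        fps_X * (proper_chain_series j * ?p ^ (j - 1)) * ?p ^ (n - 1 - j)"
      by (simp only: mult.assoc)
    also have "proper_chain_series j * ?p ^ (j - 1) = fps_of_poly (eulerian j)"
      using j by (intro less.IH) auto
    finally show "of_nat (n choose j) * ?c j * ?p ^ (n - 1) =
        fps_X * (of_nat (n choose j) * fps_of_poly (eulerian j) * ?p ^ (n - 1 - j))"
      by (simp only: mult_ac)
  qed
  also have "?p ^ (n - 1) + \<dots> = fps_of_poly (eulerian n)"
  proof -
    have X: "fps_of_poly [:0, 1 :: int:] = fps_X" by (rule fps_of_poly_fps_X)
    have p: "fps_of_poly (1 - [:0, 1 :: int:]) = ?p"
      by (simp only: fps_of_poly_diff X hom_1)
    show ?thesis
      by (subst eulerian_recurrence[OF less.prems])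
         (simp only: hom_add hom_mult hom_sum hom_power hom_of_nat X p sum_distrib_left)
  qed
  finally show ?case .
qed

lemma iterated_sum_fps:
  "Abs_fps (\<lambda>k. int (iterated_sum a j k)) * (1 - fps_X) ^ j = Abs_fps (\<lambda>k. int (a k))"
proof (induction j)
  case (Suc j)
  have "Abs_fps (\<lambda>k. int (iterated_sum a (Suc j) k)) * (1 - fps_X) = Abs_fps (\<lambda>k. int (iterated_sum a j k))"
  proof (rule fps_ext)
    fix k
    show "(Abs_fps (\<lambda>k. int (iterated_sum a (Suc j) k)) * (1 - fps_X)) $ k =
        Abs_fps (\<lambda>k. int (iterated_sum a j k)) $ k"
      by (cases k) (auto simp: right_diff_distrib)
  qed
  then have "Abs_fps (\<lambda>k. int (iterated_sum a (Suc j) k)) * (1 - fps_X) ^ Suc j =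
      Abs_fps (\<lambda>k. int (iterated_sum a j k)) * (1 - fps_X) ^ j"
    by (simp only: power_Suc mult.assoc[symmetric])
  with Suc.IH show ?case by (simp only:)
qed simp

text \<open>
  The numerical coincidence that closes the gap between the two bounds: the
  Feichtner-Yuzvinsky monomials attain equality in the lower bound.
\<close>

lemma card_proper_chain_monomials_eq_iterated_sum:
  "card (proper_chain_monomials n k) =
     iterated_sum (\<lambda>k. card (fy_monomials n k)) (n - 1) k"
proof (cases "n = 0")
  case True
  have "proper_chain_monomials 0 k = fy_monomials 0 k"
    by (auto simp: fy_monomials_def proper_chain_monomials_def chain_monomials_def chain_monomial_empty_iff
        proper_flats_def is_chain_def weighted_0)
  then show ?thesis using True by simp
next
  case False
  let ?a = "\<lambda>k. card (fy_monomials n k)"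
  let ?p = "1 - fps_X :: int fps"
  \<comment> \<open>Both sides become the Eulerian polynomial after multiplication by the same nonzero series.\<close>
  have "Abs_fps (\<lambda>k. int (iterated_sum ?a (n - 1) k)) * ?p ^ (n - 1) = Abs_fps (\<lambda>k. int (?a k))"
    by (rule iterated_sum_fps)
  also have "\<dots> = fps_of_poly (eulerian n)"
    by (rule fps_ext) (simp only: card_fy_monomials fps_nth_Abs_fps fps_of_poly_nth)
  also have "\<dots> = proper_chain_series n * ?p ^ (n - 1)"
    using False proper_chain_series_eulerian[of n] by simp
  finally have "Abs_fps (\<lambda>k. int (iterated_sum ?a (n - 1) k)) = proper_chain_series n"
  proof (rule mult_right_cancel[THEN iffD1, rotated])
    have "?p $ 0 \<noteq> 0" by simp
    then have "?p \<noteq> 0" by (metis fps_zero_nth)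
    then show "?p ^ (n - 1) \<noteq> 0" by simp
  qed
  then have "Abs_fps (\<lambda>k. int (iterated_sum ?a (n - 1) k)) $ k = int (card (proper_chain_monomials n k))"
    using False by (simp only: card_proper_chain_monomials neq0_conv)
  then show ?thesis by simp
qed

section \<open>Dimensions of the graded pieces\<close>

definition spanning_set :: "nat \<Rightarrow> nat \<Rightarrow> flat_poly set \<Rightarrow> bool" where
  "spanning_set n k B \<longleftrightarrow> finite B \<and> (\<forall>b\<in>B. b \<in> carrier (flat_poly_ring n) \<and> homogeneous k b) \<and>
     (\<forall>p. p \<in> carrier (flat_poly_ring n) \<and> homogeneous k p \<longrightarrow> p \<in> congruent_span n B)"

lemma finite_fy_monomials: "finite (fy_monomials n k)"
  unfolding fy_monomials_def by (rule card_chain_monomials) (auto intro: finite_subset[of _ "{Suc 0..n}"])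

lemma spanning_set_fy_monomials:
  "spanning_set n k (monom_eval n ` fy_monomials n k)"
  unfolding spanning_set_def
proof (intro conjI ballI allI impI)
  show "finite (monom_eval n ` fy_monomials n k)"
    by (intro finite_imageI finite_fy_monomials)
next
  fix b assume "b \<in> monom_eval n ` fy_monomials n k"
  then obtain m F where m: "b = monom_eval n m" "F \<subseteq> {1..n}" "chain_monomial small_exponent F m" "mdeg m = k"
    by (auto simp: fy_monomials_def chain_monomials_def)
  have "Poly_Mapping.keys m \<subseteq> flats n"
    using chain_monomial_keys[OF m(3)] m(2) by (auto simp: flats_def)
  then show "b \<in> carrier (flat_poly_ring n)" unfolding m(1) by (rule carrier_monom_eval)
  show "homogeneous k b" using homogeneous_monom_eval[of m n] m by simp
qed (use fy_monomials_span in auto)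

text \<open>
  The last term of every partial sum is the preceding sum at the same place, so a deficit at place \<open>k\<close> survives
  undiminished.
\<close>

lemma iterated_sum_gap:
  assumes "\<And>k. a k \<le> b k"
  shows "iterated_sum a j k + (b k - a k) \<le> iterated_sum b j k"
proof (induction j arbitrary: k)
  case 0
  then show ?case using assms[of k] by simp
next
  case (Suc j)
  have "iterated_sum a j i \<le> iterated_sum b j i" for i using Suc.IH[of i] by linarith
  then have "(\<Sum>i<k. iterated_sum a j i) \<le> (\<Sum>i<k. iterated_sum b j i)" by (intro sum_mono)
  then show ?case using Suc.IH[of k] by (simp flip: lessThan_Suc_atMost)
qed

text \<open>
  A smaller spanning set in one degree could be combined with the Feichtner-Yuzvinsky monomials in all other
  degrees, contradicting the lower bound in that degree.
\<close>

lemma card_spanning_set_ge: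
  assumes "spanning_set n k B"
  shows "card (fy_monomials n k) \<le> card B"
proof (rule ccontr)
  assume less: "\<not> ?thesis"
  let ?B = "(\<lambda>i. monom_eval n ` fy_monomials n i)(k := B)"
  let ?a = "\<lambda>i. card (?B i)" and ?b = "\<lambda>i. card (fy_monomials n i)"
  have span: "spanning_set n i (?B i)" for i
    using assms spanning_set_fy_monomials by simp
  have le: "?a i \<le> ?b i" for i
    using less card_image_le[OF finite_fy_monomials, of "monom_eval n" n i]
    by (cases "i = k") auto
  have "card (proper_chain_monomials n k) \<le> iterated_sum ?a (n - 1) k"
  proof (rule card_proper_chain_monomials_le)
    show "b \<in> carrier (flat_poly_ring n) \<and> homogeneous i b" if "b \<in> ?B i" for i b
      using span[of i] that unfolding spanning_set_def by blast
    show "p \<in> congruent_span n (?B i)" if "p \<in> carrier (flat_poly_ring n)" "homogeneous i p" for i p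
      using span[of i] that unfolding spanning_set_def by blast
    show "finite (?B i)" for i
      using span[of i] unfolding spanning_set_def by blast
  qed
  moreover have "card (proper_chain_monomials n k) = iterated_sum ?b (n - 1) k"
    by (rule card_proper_chain_monomials_eq_iterated_sum)
  moreover have "iterated_sum ?a (n - 1) k + (?b k - ?a k) \<le> iterated_sum ?b (n - 1) k"
    by (rule iterated_sum_gap) (rule le)
  ultimately have "?b k - ?a k = 0" by linarith
  then show False using less by simp
qed

lemma congruent_span_mono: "B \<subseteq> C \<Longrightarrow> congruent_span n B \<subseteq> congruent_span n C"
  using flat.span_mono[of B C] by (auto simp: congruent_span_def)

text \<open>
  A redundant element could be dropped, which would leave a spanning set that is too small.
\<close>

lemma minimal_spanning_set_independent:
  assumes B: "spanning_set n k B" and card: "card B = card (fy_monomials n k)"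
    and u: "u \<in> B"
  shows "u \<notin> congruent_span n (B - {u})"
proof
  assume *: "u \<in> congruent_span n (B - {u})"
  have sub: "B \<subseteq> congruent_span n (B - {u})"
    using * congruent_span_base[of _ "B - {u}" n] by blast
  have "spanning_set n k (B - {u})"
    unfolding spanning_set_def
  proof (intro conjI ballI allI impI)
    fix p assume p: "p \<in> carrier (flat_poly_ring n) \<and> homogeneous k p"
    then obtain s where s: "s \<in> flat.span B" "p - s \<in> chow_ideal n"
      using B by (auto simp: spanning_set_def congruent_span_def)
    show "p \<in> congruent_span n (B - {u})"
      by (rule congruent_span_cong[OF s(2) congruent_span_span[OF s(1) sub]])
  qed (use B in \<open>auto simp: spanning_set_def\<close>)
  then have "card B \<le> card (B - {u})" using card_spanning_set_ge card by metis
  moreover have "card (B - {u}) < card B"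
    using B u by (intro card_Diff1_less) (auto simp: spanning_set_def)
  ultimately show False by simp
qed

text \<open>
  Neither the multiples of linear forms nor the polynomials without chain monomials have a constant term.
\<close>

lemma one_notin_chow_ideal: "1 \<notin> chow_ideal n"
proof
  assume "1 \<in> chow_ideal n"
  then obtain q j where qj: "j \<in> nonchain_polys n" "1 = (\<Sum>i\<in>{1..n}. theta n i * q i) + j"
    using chow_ideal_decompose by blast
  have "restrict_mons (\<lambda>m. mdeg m = 0) 1 = restrict_mons (\<lambda>m. mdeg m = 0) j"
    by (simp only: qj(2) restrict_mons_add restrict_mons_sum restrict_degree_mult(2)[OF homogeneous_theta]) simp
  from arg_cong[OF this, of "\<lambda>p. Poly_Mapping.lookup p 0"]
  have "Poly_Mapping.lookup j 0 = 1"
    by (simp add: lookup_restrict_mons weighted_0)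
  moreover have "is_chain 0" by (simp add: is_chain_def)
  then have "0 \<notin> Poly_Mapping.keys j" using qj(1) by (auto simp: nonchain_polys_def)
  ultimately show False by (simp add: in_keys_iff)
qed

lemma chow_class_hom: "ring_hom_ring (flat_poly_ring n) (chow_ring n) (chow_class n)"
  using ideal.rcos_ring_hom_ring[OF ideal_chow_ideal, of n]
  by (simp add: chow_ring_def chow_class_def[abs_def])

lemma chow_class_eq_iff:
  assumes "p \<in> carrier (flat_poly_ring n)" "q \<in> carrier (flat_poly_ring n)"
  shows "chow_class n p = chow_class n q \<longleftrightarrow> p - q \<in> chow_ideal n"
proof -
  interpret cring "flat_poly_ring n" by (rule cring_flat_poly_ring)
  show ?thesis
    using quotient_eq_iff_same_a_r_cos[OF ideal_chow_ideal assms] assms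
    by (simp add: chow_class_def a_minus_def flat_poly_ring_uminus flat_poly_ring_ops)
qed

lemma subfield_constants: "subfield (range flat_const) (flat_poly_ring n)"
proof -
  interpret cring "flat_poly_ring n" by (rule cring_flat_poly_ring)
  have sub: "subring (range flat_const) (flat_poly_ring n)"
  proof (rule subringI)
    show "range flat_const \<subseteq> carrier (flat_poly_ring n)" by (auto simp: carrier_const)
    show "\<one>\<^bsub>flat_poly_ring n\<^esub> \<in> range flat_const"
      using rangeI[of flat_const 1] by (simp add: flat_poly_ring_ops flat_const_simps)
  next
    fix h assume "h \<in> range flat_const"
    then obtain c where "h = flat_const c" by blast
    then show "\<ominus>\<^bsub>flat_poly_ring n\<^esub> h \<in> range flat_const"
      using rangeI[of flat_const "- c"] by (simp add: flat_poly_ring_uminus carrier_const flat_const_simps(5))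
  next
    fix h h' assume "h \<in> range flat_const" "h' \<in> range flat_const"
    then obtain c d where "h = flat_const c" "h' = flat_const d" by blast
    then show "h \<otimes>\<^bsub>flat_poly_ring n\<^esub> h' \<in> range flat_const"
      "h \<oplus>\<^bsub>flat_poly_ring n\<^esub> h' \<in> range flat_const"
      using rangeI[of flat_const "c * d"] rangeI[of flat_const "c + d"]
      by (simp_all add: flat_poly_ring_ops flat_const_simps(3,4))
  qed
  have inj: "flat_const c = 0 \<longleftrightarrow> c = 0" for c
    using lookup_flat_const_mult[of c 1 0] by (auto simp: flat_const_simps)
  show ?thesis
  proof (rule subfieldI)
    show "subcring (range flat_const) (flat_poly_ring n)"
      by (rule subcringI[OF sub]) (auto simp: flat_poly_ring_ops mult.commute)
    show "Units (flat_poly_ring n \<lparr>carrier := range flat_const\<rparr>) = range flat_const - {\<zero>\<^bsub>flat_poly_ring n\<^esub>}"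
    proof (intro equalityI subsetI)
      fix h assume "h \<in> Units (flat_poly_ring n \<lparr>carrier := range flat_const\<rparr>)"
      then obtain h' where "h \<in> range flat_const" "h' * h = 1"
        by (auto simp: Units_def flat_poly_ring_def)
      then show "h \<in> range flat_const - {\<zero>\<^bsub>flat_poly_ring n\<^esub>}"
        by (auto simp: flat_poly_ring_ops)
    next
      fix h assume "h \<in> range flat_const - {\<zero>\<^bsub>flat_poly_ring n\<^esub>}"
      then obtain c where c: "h = flat_const c" "c \<noteq> 0" by (auto simp: flat_poly_ring_ops inj)
      have "flat_const (inverse c) * h = 1"
        using c by (simp add: flat_const_simps(2) flip: flat_const_simps(4))
      then show "h \<in> Units (flat_poly_ring n \<lparr>carrier := range flat_const\<rparr>)"
        using c by (auto simp: Units_def flat_poly_ring_def mult.commute)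
    qed
  qed
qed

lemma subfield_chow_scalars: "subfield (chow_scalars n) (chow_ring n)"
proof -
  interpret ring_hom_ring "flat_poly_ring n" "chow_ring n" "chow_class n" by (rule chow_class_hom)
  have "chow_class n 1 \<noteq> chow_class n 0"
    using one_notin_chow_ideal[of n] by (simp add: chow_class_eq_iff carrier_0 carrier_1)
  then have "\<one>\<^bsub>chow_ring n\<^esub> \<noteq> \<zero>\<^bsub>chow_ring n\<^esub>"
    using hom_one hom_zero by (simp add: flat_poly_ring_ops)
  from img_is_subfield(2)[OF subfield_constants this] show ?thesis
    by (simp add: chow_scalars_def image_image)
qed

text \<open>
  Linear algebra over the copy of the rationals inside the Chow ring is transported from the
  rational vector space of all polynomials.
\<close>

lemma Span_chow_class:
  assumes "set us \<subseteq> carrier (flat_poly_ring n)"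
  shows "ring.Span (chow_ring n) (chow_scalars n) (map (chow_class n) us) = chow_class n ` flat.span (set us)"
  using assms
proof (induction us)
  interpret ring_hom_ring "flat_poly_ring n" "chow_ring n" "chow_class n" by (rule chow_class_hom)
  case Nil
  show ?case using hom_zero by (simp add: S.Span.simps flat_poly_ring_ops)
next
  interpret ring_hom_ring "flat_poly_ring n" "chow_ring n" "chow_class n" by (rule chow_class_hom)
  case (Cons u us)
  have u: "u \<in> carrier (flat_poly_ring n)" and us: "set us \<subseteq> carrier (flat_poly_ring n)"
    using Cons.prems by auto
  have hom: "chow_class n (flat_const c) \<otimes>\<^bsub>chow_ring n\<^esub> chow_class n u \<oplus>\<^bsub>chow_ring n\<^esub> chow_class n v =
      chow_class n (flat_const c * u + v)" if "v \<in> flat.span (set us)" for c v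
  proof -
    have v: "v \<in> carrier (flat_poly_ring n)" by (rule carrier_span[OF that us])
    show ?thesis
      using hom_mult[OF carrier_const u, of c] hom_add[OF carrier_mult[OF carrier_const u] v, of c]
      by (simp add: flat_poly_ring_ops)
  qed
  have "S.Span (chow_scalars n) (map (chow_class n) (u # us)) =
      S.line_extension (chow_scalars n) (chow_class n u) (S.Span (chow_scalars n) (map (chow_class n) us))"
    by simp
  also have "\<dots> = S.line_extension (chow_scalars n) (chow_class n u) (chow_class n ` flat.span (set us))"
    using Cons.IH[OF us] by (simp only:)
  also have "\<dots> = chow_class n ` flat.span (set (u # us))"
  proof (intro equalityI subsetI)
    fix x assume "x \<in> S.line_extension (chow_scalars n) (chow_class n u) (chow_class n ` flat.span (set us))"
    then obtain c v where v: "v \<in> flat.span (set us)" and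
      x: "x = chow_class n (flat_const c) \<otimes>\<^bsub>chow_ring n\<^esub> chow_class n u \<oplus>\<^bsub>chow_ring n\<^esub> chow_class n v"
      by (auto simp: S.line_extension_mem_iff chow_scalars_def)
    have "flat_const c * u + v \<in> flat.span (set (u # us))"
      unfolding list.set flat.span_insert by (rule CollectI, rule exI[of _ c]) (simp add: v)
    then show "x \<in> chow_class n ` flat.span (set (u # us))"
      unfolding x hom[OF v] by (rule imageI)
  next
    fix x assume "x \<in> chow_class n ` flat.span (set (u # us))"
    then obtain p where p: "x = chow_class n p" "p \<in> flat.span (set (u # us))" by blast
    then obtain c where c: "p - flat_const c * u \<in> flat.span (set us)"
      unfolding list.set flat.span_insert by blast
    have "x = chow_class n (flat_const c) \<otimes>\<^bsub>chow_ring n\<^esub> chow_class n u \<oplus>\<^bsub>chow_ring n\<^esub>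
        chow_class n (p - flat_const c * u)"
      unfolding hom[OF c] p(1) by simp
    then show "x \<in> S.line_extension (chow_scalars n) (chow_class n u) (chow_class n ` flat.span (set us))"
      unfolding S.line_extension_mem_iff chow_scalars_def using c by blast
  qed
  finally show ?case .
qed

lemma independent_chow_class:
  assumes "distinct us" "set us \<subseteq> carrier (flat_poly_ring n)"
    and "\<And>u. u \<in> set us \<Longrightarrow> u \<notin> congruent_span n (set us - {u})"
  shows "ring.independent (chow_ring n) (chow_scalars n) (map (chow_class n) us)"
  using assms
proof (induction us)
  interpret ring_hom_ring "flat_poly_ring n" "chow_ring n" "chow_class n" by (rule chow_class_hom)
  case Nil
  show ?case by (simp add: S.independent.li_Nil)
next
  interpret ring_hom_ring "flat_poly_ring n" "chow_ring n" "chow_class n" by (rule chow_class_hom)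
  case (Cons u us)
  have us: "set us \<subseteq> carrier (flat_poly_ring n)" and u: "u \<in> carrier (flat_poly_ring n)"
    using Cons.prems by auto
  have indep: "u \<notin> congruent_span n (set us)"
    using Cons.prems(3)[of u] Cons.prems(1) by simp
  have "S.independent (chow_scalars n) (map (chow_class n) us)"
  proof (rule Cons.IH)
    fix v assume v: "v \<in> set us"
    have "set us - {v} \<subseteq> set (u # us) - {v}" by auto
    then show "v \<notin> congruent_span n (set us - {v})"
      using Cons.prems(3)[of v] v congruent_span_mono[of "set us - {v}" "set (u # us) - {v}" n] by auto
  qed (use Cons.prems in auto)
  moreover have "chow_class n u \<notin> S.Span (chow_scalars n) (map (chow_class n) us)"
    unfolding Span_chow_class[OF us]
  proof
    assume "chow_class n u \<in> chow_class n ` flat.span (set us)"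
    then obtain s where s: "s \<in> flat.span (set us)" "chow_class n u = chow_class n s" by blast
    then have "u - s \<in> chow_ideal n"
      using chow_class_eq_iff[OF u carrier_span[OF s(1) us]] by simp
    then show False using indep s(1) by (auto simp: congruent_span_def)
  qed
  ultimately show ?case
    using hom_closed[OF u] by (simp add: S.independent.li_Cons del: S.Span.simps)
qed

lemma chow_graded_piece_eq:
  assumes B: "spanning_set n k B"
  shows "chow_graded_piece n k = chow_class n ` flat.span B"
proof (intro equalityI subsetI)
  fix x assume "x \<in> chow_graded_piece n k"
  then obtain p where p: "x = chow_class n p" "p \<in> carrier (flat_poly_ring n)" "homogeneous k p"
    by (auto simp: chow_graded_piece_def)
  then obtain s where s: "s \<in> flat.span B" "p - s \<in> chow_ideal n"
    using B by (auto simp: spanning_set_def congruent_span_def)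
  have "s \<in> carrier (flat_poly_ring n)"
    by (rule carrier_span[OF s(1)]) (use B in \<open>auto simp: spanning_set_def\<close>)
  then have "x = chow_class n s" using s p by (simp add: chow_class_eq_iff)
  then show "x \<in> chow_class n ` flat.span B" using s by blast
next
  fix x assume "x \<in> chow_class n ` flat.span B"
  then obtain s where s: "x = chow_class n s" "s \<in> flat.span B" by blast
  have "s \<in> carrier (flat_poly_ring n)"
    by (rule carrier_span[OF s(2)]) (use B in \<open>auto simp: spanning_set_def\<close>)
  moreover have "homogeneous k s"
    by (rule homogeneous_span[OF s(2)]) (use B in \<open>auto simp: spanning_set_def\<close>)
  ultimately show "x \<in> chow_graded_piece n k"
    using s(1) by (auto simp: chow_graded_piece_def)
qed

text \<open>
  A list of the distinct values of the Feichtner-Yuzvinsky monomials is a basis: it spans, and it is independent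
  because a spanning set of this size is minimal.
\<close>

lemma eulerian_number_eq: "eulerian_number n k = card (fy_monomials n k)"
proof -
  interpret ring_hom_ring "flat_poly_ring n" "chow_ring n" "chow_class n" by (rule chow_class_hom)
  define B where "B = monom_eval n ` fy_monomials n k"
  have span: "spanning_set n k B"
    unfolding B_def by (rule spanning_set_fy_monomials)
  have card: "card B = card (fy_monomials n k)"
    using card_spanning_set_ge[OF span] card_image_le[OF finite_fy_monomials, of "monom_eval n" n k]
    unfolding B_def by simp
  have carr: "B \<subseteq> carrier (flat_poly_ring n)" and fin: "finite B"
    using span by (auto simp: spanning_set_def)
  obtain us where us: "set us = B" "distinct us"
    using finite_distinct_list[OF fin] by blast
  have "S.independent (chow_scalars n) (map (chow_class n) us)"
    by (rule independent_chow_class) (use us carr minimal_spanning_set_independent[OF span card] in auto)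
  then have "S.dimension (length (map (chow_class n) us)) (chow_scalars n)
      (S.Span (chow_scalars n) (map (chow_class n) us))"
    by (rule S.dimension_independent)
  then have "S.dimension (card B) (chow_scalars n) (chow_graded_piece n k)"
    using Span_chow_class[of us n] chow_graded_piece_eq[OF span] us carr distinct_card[OF us(2)]
    by (simp del: S.Span.simps)
  then have "(S.dim over chow_scalars n) (chow_graded_piece n k) = card B"
    by (rule S.dimI[OF subfield_chow_scalars])
  then show ?thesis by (simp add: eulerian_number_def over_def card)
qed

lemma eulerian_poly_eq: "eulerian_poly n = eulerian n"
proof -
  have "chow_hilbert_series n = fps_of_poly (eulerian n)"
    by (rule fps_ext)
       (simp only: chow_hilbert_series_def eulerian_number_eq card_fy_monomials
         fps_nth_Abs_fps fps_of_poly_nth)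
  then show ?thesis
    unfolding eulerian_poly_def by (intro the_equality) (simp_all add: fps_of_poly_eq_iff)
qed

theorem corollary1p5:
  fixes n m :: nat
  assumes "n > 0" and "m > 0"
  shows "eulerian_poly (n + m) =
           eulerian_poly n * eulerian_poly m +
           [:0, 1:] * (\<Sum>r\<in>{0<..n}. \<Sum>s\<in>{0<..m}.
              of_nat (n choose r) * of_nat (m choose s) *
              eulerian_poly r * eulerian_poly s * eulerian_poly (n + m - r - s))"
  unfolding eulerian_poly_eq by (rule eulerian_addition)

end
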